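(* Consider the birational mappings $$f(x,y)=\left(\alpha_0+\alpha_1x+y,\ \frac{\beta_0}{\gamma_0+y}\right),\qquad \alpha_0,\alpha_1,\beta_0,\gamma_0\in\mathbb{C},\quad \alpha_1\neq0\neq\beta_0,$$ and let $h(y):=\frac{\beta_0}{\gamma_0+y}$. Then the following hold. (a) If $h$ is not a periodic map, then $f$ has the unique invariant fibration $V_1(x,y)=y$. (b) If $h$ is a $k$-periodic map and $1+\alpha_1^k+\alpha_1^{2k}+\cdots+\alpha_1^{nk}\neq0$ for all $n\in\mathbb{N}$, then $f$ is integrable, with $$H_1(x,y)=y+h(y)+h(h(y))+\cdots+h^{k-1}(y)$$ a first integral, and $f$ also has a second invariant fibration $V_2(x,y)$: ($b_1$) If $\alpha_1^k\neq1$, we can assume (after a translation of coordinates) that $\alpha_0=0$, and then $$V_2(x,y)=(\alpha_1^k-1)x+\alpha_1^{k-1}y+\alpha_1^{k-2}h(y)+\alpha_1^{k-3}h^2(y)+\cdots+\alpha_1h^{k-2}(y)+h^{k-1}(y)$$ satisfies $V_2(f(x,y))=\alpha_1V_2(x,y)$. ($b_2$) If $\alpha_1^k=1$ but $\alpha_1\neq1$, we can assume (after a translation of coordinates) that $\alpha_0=0$, and then $$V_2(x,y)=\frac{kx+(k-1)\alpha_1^{k-1}y+(k-2)\alpha_1^{k-2}h(y)+(k-3)\alpha_1^{k-3}h^2(y)+\cdots+2\alpha_1^2h^{k-3}(y)+\alpha_1h^{k-2}(y)}{\alpha_1^{k-1}y+\alpha_1^{k-2}h(y)+\alpha_1^{k-3}h^2(y)+\cdots+\alpha_1h^{k-2}(y)+h^{k-1}(y)}$$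 satisfies $V_2(f(x,y))=V_2(x,y)+1$. ($b_3$) If $\alpha_1=1$, then $$V_2(x,y)=\frac{kx+(k-1)y+(k-2)h(y)+(k-3)h^2(y)+\cdots+2h^{k-3}(y)+h^{k-2}(y)}{k\alpha_0+y+h(y)+h^2(y)+\cdots+h^{k-2}(y)+h^{k-1}(y)}$$ satisfies $V_2(f(x,y))=V_2(x,y)+1$. (c) If $h$ is a $k$-periodic map and $1+\alpha_1^k+\alpha_1^{2k}+\cdots+\alpha_1^{nk}=0$ for some $n\in\mathbb{N}$, then $f$ has a second first integral $H_2(x,y)$, which (assuming, after a translation of coordinates, that $\alpha_0=0$) can be given by $H_2(x,y)=\bigl(V_2(x,y)\bigr)^{(n+1)k}$, where $$V_2(x,y)=(\alpha_1^k-1)x+\alpha_1^{k-1}y+\alpha_1^{k-2}h(y)+\alpha_1^{k-3}h^2(y)+\cdots+\alpha_1h^{k-2}(y)+h^{k-1}(y).$$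
   Context: $h^{j}$ denotes the $j$-th iterate of $h$. A one-dimensional Möbius map $h$ is $k$-periodic if $h^k=\mathrm{id}$ with $k\ge1$ minimal; it is periodic if it is $k$-periodic for some $k$. A fibration given by a nonconstant rational function $V$ is invariant under $f$ if $V\circ f=\varphi\circ V$ for some Möbius map $\varphi$; uniqueness means that $f$ preserves no other fibration (fibrations being identified when they have the same fibres). A first integral of $f$ is a nonconstant rational function $H$ with $H\circ f=H$; $f$ is integrable if it has a first integral. In (c), "second" first integral means in addition to $H_1(x,y)=y+h(y)+\cdots+h^{k-1}(y)$. *)

theory Defs
  imports
    Complex_Main
    "HOL-Computational_Algebra.Computational_Algebra"
    "HOL-Computational_Algebra.Field_as_Ring"
begin

text \<open>
  The field \<open>\<complex>(x, y)\<close> is the fraction field of \<open>\<complex>[y][x]\<close>: in \<^typ>\<open>complex poly poly\<close> the outer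
  variable is \<open>x\<close> and the inner variable is \<open>y\<close>.
\<close>

type_synonym ratfun = "complex poly poly fract"

definition cst :: "complex \<Rightarrow> ratfun" where
  "cst c = to_fract [:[:c:]:]"

definition X :: ratfun where
  "X = to_fract [:0, 1:]"

definition Y :: ratfun where
  "Y = to_fract [:[:0, 1:]:]"

definition nonconstant :: "ratfun \<Rightarrow> bool" where
  "nonconstant V \<longleftrightarrow> V \<notin> range cst"

text \<open>A rational self-map of the plane is the pair of its coordinate functions.\<close>

type_synonym ratmap = "ratfun \<times> ratfun"

definition poly_subst :: "complex poly poly \<Rightarrow> ratmap \<Rightarrow> ratfun" where
  "poly_subst P f = poly (map_poly (\<lambda>p. poly (map_poly cst p) (snd f)) P) (fst f)"

text \<open>
  The composition \<open>V \<circ> f\<close>. It has its usual meaning whenever the denominator of \<open>V\<close> does not vanish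
  identically along \<open>f\<close>, in particular for every dominant \<open>f\<close> (all maps below are birational).
\<close>

definition rcomp :: "ratfun \<Rightarrow> ratmap \<Rightarrow> ratfun" (infixl "\<circ>\<^sub>r" 75) where
  "V \<circ>\<^sub>r f = poly_subst (fst (quot_of_fract V)) f / poly_subst (snd (quot_of_fract V)) f"

definition ratmap_comp :: "ratmap \<Rightarrow> ratmap \<Rightarrow> ratmap" where
  "ratmap_comp f g = (fst f \<circ>\<^sub>r g, snd f \<circ>\<^sub>r g)"

definition translation :: "complex \<Rightarrow> complex \<Rightarrow> ratmap" where
  "translation a b = (X + cst a, Y + cst b)"

text \<open>\<open>g = \<tau>\<^sup>-\<^sup>1 \<circ> f \<circ> \<tau>\<close> for the translation \<open>\<tau>\<close> by \<open>(a, b)\<close>.\<close>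

definition conj_by_translation :: "complex \<Rightarrow> complex \<Rightarrow> ratmap \<Rightarrow> ratmap \<Rightarrow> bool" where
  "conj_by_translation a b f g \<longleftrightarrow>
     ratmap_comp f (translation a b) = ratmap_comp (translation a b) g"

text \<open>
  \<open>\<phi> \<circ> V\<close> for the Moebius map \<open>\<phi>(z) = (a z + b) / (c z + d)\<close>. If \<open>V\<close> is nonconstant and
  \<open>a d - b c \<noteq> 0\<close>, then the denominator is nonzero and \<open>\<phi> \<circ> V\<close> is again nonconstant.
\<close>

definition moebius :: "complex \<Rightarrow> complex \<Rightarrow> complex \<Rightarrow> complex \<Rightarrow> ratfun \<Rightarrow> ratfun" where
  "moebius a b c d V = (cst a * V + cst b) / (cst c * V + cst d)"

definition invariant_fibration :: "ratmap \<Rightarrow> ratfun \<Rightarrow> bool" where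
  "invariant_fibration f V \<longleftrightarrow>
     nonconstant V \<and> (\<exists>a b c d. a * d - b * c \<noteq> 0 \<and> V \<circ>\<^sub>r f = moebius a b c d V)"

definition first_integral :: "ratmap \<Rightarrow> ratfun \<Rightarrow> bool" where
  "first_integral f H \<longleftrightarrow> nonconstant H \<and> H \<circ>\<^sub>r f = H"

definition integrable_map :: "ratmap \<Rightarrow> bool" where
  "integrable_map f \<longleftrightarrow> (\<exists>H. first_integral f H)"

text \<open>
  The fibres of \<open>V = P / Q\<close> (in lowest terms) are the irreducible components of the curves
  \<open>a P + b Q = 0\<close> of the pencil, here given by their irreducible equations. Working with components
  rather than with full level sets is essential: \<open>V\<close> and \<open>V\<^sup>2\<close> define the same fibration, although
  a level set of \<open>V\<^sup>2\<close> is in general the union of two level sets of \<open>V\<close>.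
\<close>

definition fibres :: "ratfun \<Rightarrow> complex poly poly set" where
  "fibres V = {R. irreducible R \<and>
     (\<exists>a b. (a, b) \<noteq> (0, 0) \<and>
        R dvd [:[:a:]:] * fst (quot_of_fract V) + [:[:b:]:] * snd (quot_of_fract V))}"

definition same_fibration :: "ratfun \<Rightarrow> ratfun \<Rightarrow> bool" where
  "same_fibration V W \<longleftrightarrow> fibres V = fibres W"

text \<open>
  "Second" means in addition to a given \<open>H\<close>, hence with different fibres: powers of \<open>H\<close> and the like
  do not count.
\<close>

definition second_invariant_fibration :: "ratmap \<Rightarrow> ratfun \<Rightarrow> ratfun \<Rightarrow> bool" where
  "second_invariant_fibration f H V \<longleftrightarrow> invariant_fibration f V \<and> \<not> same_fibration V H"

definition second_first_integral :: "ratmap \<Rightarrow> ratfun \<Rightarrow> ratfun \<Rightarrow> bool" where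
  "second_first_integral f H V \<longleftrightarrow> first_integral f V \<and> \<not> same_fibration V H"

definition unique_invariant_fibration :: "ratmap \<Rightarrow> ratfun \<Rightarrow> bool" where
  "unique_invariant_fibration f V \<longleftrightarrow>
     invariant_fibration f V \<and> (\<forall>W. invariant_fibration f W \<longrightarrow> same_fibration W V)"

text \<open>
  The Moebius map \<open>h(z) = \<beta>\<^sub>0 / (\<gamma>\<^sub>0 + z)\<close>, acting on rational functions by \<open>V \<mapsto> h \<circ> V\<close>. Thus the
  rational function \<open>h\<^sup>j(y)\<close> is \<open>(h_map \<beta>\<^sub>0 \<gamma>\<^sub>0 ^^ j) Y\<close>, and \<open>h\<^sup>k = id\<close> is the identity
  \<open>h\<^sup>k(y) = y\<close> of rational functions.
\<close>

definition h_map :: "complex \<Rightarrow> complex \<Rightarrow> ratfun \<Rightarrow> ratfun" where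
  "h_map \<beta>\<^sub>0 \<gamma>\<^sub>0 V = cst \<beta>\<^sub>0 / (cst \<gamma>\<^sub>0 + V)"

definition h_iter :: "complex \<Rightarrow> complex \<Rightarrow> nat \<Rightarrow> ratfun" where
  "h_iter \<beta>\<^sub>0 \<gamma>\<^sub>0 j = (h_map \<beta>\<^sub>0 \<gamma>\<^sub>0 ^^ j) Y"

definition k_periodic :: "complex \<Rightarrow> complex \<Rightarrow> nat \<Rightarrow> bool" where
  "k_periodic \<beta>\<^sub>0 \<gamma>\<^sub>0 k \<longleftrightarrow>
     k \<ge> 1 \<and> h_iter \<beta>\<^sub>0 \<gamma>\<^sub>0 k = Y \<and> (\<forall>j. 1 \<le> j \<and> j < k \<longrightarrow> h_iter \<beta>\<^sub>0 \<gamma>\<^sub>0 j \<noteq> Y)"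

definition periodic :: "complex \<Rightarrow> complex \<Rightarrow> bool" where
  "periodic \<beta>\<^sub>0 \<gamma>\<^sub>0 \<longleftrightarrow> (\<exists>k. k_periodic \<beta>\<^sub>0 \<gamma>\<^sub>0 k)"

definition f_map :: "complex \<Rightarrow> complex \<Rightarrow> complex \<Rightarrow> complex \<Rightarrow> ratmap" where
  "f_map \<alpha>\<^sub>0 \<alpha>\<^sub>1 \<beta>\<^sub>0 \<gamma>\<^sub>0 = (cst \<alpha>\<^sub>0 + cst \<alpha>\<^sub>1 * X + Y, h_map \<beta>\<^sub>0 \<gamma>\<^sub>0 Y)"

definition H1 :: "complex \<Rightarrow> complex \<Rightarrow> nat \<Rightarrow> ratfun" where
  "H1 \<beta>\<^sub>0 \<gamma>\<^sub>0 k = (\<Sum>j<k. h_iter \<beta>\<^sub>0 \<gamma>\<^sub>0 j)"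

definition V2_b1 :: "complex \<Rightarrow> complex \<Rightarrow> complex \<Rightarrow> nat \<Rightarrow> ratfun" where
  "V2_b1 \<alpha>\<^sub>1 \<beta>\<^sub>0 \<gamma>\<^sub>0 k =
     cst (\<alpha>\<^sub>1 ^ k - 1) * X + (\<Sum>j<k. cst (\<alpha>\<^sub>1 ^ (k - 1 - j)) * h_iter \<beta>\<^sub>0 \<gamma>\<^sub>0 j)"

definition V2_b2 :: "complex \<Rightarrow> complex \<Rightarrow> complex \<Rightarrow> nat \<Rightarrow> ratfun" where
  "V2_b2 \<alpha>\<^sub>1 \<beta>\<^sub>0 \<gamma>\<^sub>0 k =
     (of_nat k * X + (\<Sum>j<k - 1. of_nat (k - 1 - j) * cst (\<alpha>\<^sub>1 ^ (k - 1 - j)) * h_iter \<beta>\<^sub>0 \<gamma>\<^sub>0 j))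
     / (\<Sum>j<k. cst (\<alpha>\<^sub>1 ^ (k - 1 - j)) * h_iter \<beta>\<^sub>0 \<gamma>\<^sub>0 j)"

definition V2_b3 :: "complex \<Rightarrow> complex \<Rightarrow> complex \<Rightarrow> nat \<Rightarrow> ratfun" where
  "V2_b3 \<alpha>\<^sub>0 \<beta>\<^sub>0 \<gamma>\<^sub>0 k =
     (of_nat k * X + (\<Sum>j<k - 1. of_nat (k - 1 - j) * h_iter \<beta>\<^sub>0 \<gamma>\<^sub>0 j))
     / (of_nat k * cst \<alpha>\<^sub>0 + (\<Sum>j<k. h_iter \<beta>\<^sub>0 \<gamma>\<^sub>0 j))"

end

theory Submission
  imports Defs
begin

text \<open>
  The map is a skew product over the Moebius map \<open>h\<close>: its second coordinate is \<open>h(y)\<close>, and its first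
  one is affine in \<open>x\<close> with constant slope. Composition with a dominant map is an endomorphism of the
  field \<open>\<complex>(x, y)\<close> (\<open>rcomp_add\<close>, \<open>rcomp_mult\<close>), so all equations can be handled algebraically once the
  images of \<open>x\<close> and \<open>y\<close> are known.

  Suppose first that \<open>h\<close> has period \<open>k\<close>. The orbit sum \<open>S = \<Sum>\<^sub>j \<alpha>\<^sub>1\<^sup>k\<^sup>-\<^sup>1\<^sup>-\<^sup>j h\<^sup>j(y)\<close> telescopes to
  \<open>S \<circ> f = \<alpha>\<^sub>1 S + (1 - \<alpha>\<^sub>1\<^sup>k) y\<close>, and a multiple of \<open>x\<close> absorbs the last term; this is the
  eigenfunction for \<open>\<alpha>\<^sub>1\<^sup>k \<noteq> 1\<close> (\<open>eigenfunction_rcomp\<close>). If \<open>\<alpha>\<^sub>1\<^sup>k = 1\<close>, the term is absent and \<open>S\<close> itself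
  is an eigenfunction; with the additional weights \<open>k - 1 - j\<close> in the sum and the extra term \<open>k x\<close>
  one obtains an \<open>N\<close> with \<open>N \<circ> f = \<alpha>\<^sub>1 (N + S)\<close> when \<open>\<alpha>\<^sub>0 = 0\<close>, so that \<open>N / S\<close> is translated by \<open>1\<close>; for
  \<open>\<alpha>\<^sub>1 = 1\<close> a constant added to \<open>S\<close> accounts for \<open>\<alpha>\<^sub>0\<close> (\<open>translating_function_rcomp\<close>).
  Orbit sums are not constant because only their first term has a pole
  at \<open>y = \<infinity>\<close> (\<open>nonconstant_iterate_sum\<close>). The functions found in this way involve \<open>x\<close>, hence have a
  fibre of positive degree in \<open>x\<close>, whereas all fibres of \<open>H\<^sub>1\<close> are lines \<open>y = c\<close>; so the two
  fibrations differ.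

  Suppose now that \<open>h\<close> is not periodic and that \<open>W \<circ> f = \<phi> \<circ> W\<close>. Moving a fixed point of \<open>\<phi>\<close> to
  infinity gives \<open>W \<circ> f = \<mu> W + \<epsilon>\<close> (\<open>moebius_to_affine\<close>). If \<open>W\<close> involves \<open>x\<close>, then, after subtracting
  its value at \<open>x = \<infinity>\<close> and taking a reciprocal if necessary, \<open>W\<close> has a pole of some order \<open>d > 0\<close> at
  \<open>x = \<infinity>\<close> (\<open>yfield_if_semi_invariant\<close>). Let \<open>T(y)\<close> be the quotient of its two leading coefficients
  in \<open>x\<close>. Comparing these coefficients on both sides yields
  \<open>T(h(y)) = \<alpha>\<^sub>1 T(y) - d (y + \<alpha>\<^sub>0) + \<kappa> v(y)\<close> with a rational \<open>v\<close> such that \<open>v(h(y)) = c v(y)\<close>. There are no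
  such rational functions (\<open>no_rational_solution\<close>): at the finite points of the orbit of \<open>\<infinity>\<close>, where \<open>v\<close>
  is bounded for the same reason, the equation makes \<open>T\<close> bounded near a point if and only if it is
  bounded near its image under \<open>h\<close>. The orbit of \<open>\<infinity>\<close> is infinite in both directions because \<open>h\<close> is not periodic, and \<open>T\<close> has only finitely many poles; so
  \<open>T\<close> is bounded near \<open>h(\<infinity>) = 0\<close>, near \<open>h\<^sup>-\<^sup>1(\<infinity>) = - \<gamma>\<^sub>0\<close>, and therefore near \<open>\<infinity>\<close> itself. As
  \<open>y \<rightarrow> \<infinity>\<close>, the equation then bounds \<open>d y\<close>, which is absurd. Hence \<open>W\<close> is a function of \<open>y\<close> alone and
  its fibres are those of \<open>y\<close> (\<open>fibres_yfield\<close>).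
\<close>

section \<open>Substitution as a field homomorphism\<close>

definition spec :: "complex \<Rightarrow> complex poly poly \<Rightarrow> complex poly" where
  "spec y P = map_poly (\<lambda>p. poly p y) P"

definition ev :: "complex poly poly \<Rightarrow> complex \<Rightarrow> complex \<Rightarrow> complex" where
  "ev P x y = poly (spec y P) x"

lemma coeff_spec [simp]: "coeff (spec y P) i = poly (coeff P i) y"
  by (simp add: spec_def coeff_map_poly)

lemma spec_0 [simp]: "spec y 0 = 0"
  by (simp add: spec_def)

lemma spec_pCons [simp]: "spec y (pCons p P) = pCons (poly p y) (spec y P)"
  by (rule poly_eqI) (auto simp: coeff_pCons split: nat.split)

lemma spec_add [simp]: "spec y (P + Q) = spec y P + spec y Q"
  by (rule poly_eqI) simp

lemma spec_diff [simp]: "spec y (P - Q) = spec y P - spec y Q"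
  by (rule poly_eqI) simp

lemma spec_mult [simp]: "spec y (P * Q) = spec y P * spec y Q"
  by (rule poly_eqI) (simp add: coeff_mult poly_sum)

lemma spec_1 [simp]: "spec y 1 = 1"
  by (simp add: one_pCons)

lemma spec_smult [simp]: "spec y (smult p P) = smult (poly p y) (spec y P)"
  by (rule poly_eqI) simp

lemma spec_power [simp]: "spec y (P ^ n) = spec y P ^ n"
  by (induction n) auto

lemma degree_spec_le: "degree (spec y P) \<le> degree P"
  by (rule degree_le) (simp add: coeff_eq_0)

lemma finite_spec_eq_0:
  assumes "P \<noteq> 0"
  shows "finite {y. spec y P = 0}"
proof (rule finite_subset)
  show "{y. spec y P = 0} \<subseteq> {y. poly (lead_coeff P) y = 0}"
    by (auto simp flip: coeff_spec)
qed (use assms in \<open>auto intro: poly_roots_finite\<close>)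

lemma ev_simps [simp]:
  "ev 0 x y = 0" "ev 1 x y = 1" "ev (pCons p P) x y = poly p y + x * ev P x y"
  "ev (P + Q) x y = ev P x y + ev Q x y" "ev (P * Q) x y = ev P x y * ev Q x y"
  "ev (P ^ n) x y = ev P x y ^ n"
  by (simp_all add: ev_def poly_power)

lemma zero_if_ev_zero:
  assumes "finite S" "\<And>x y. y \<notin> S \<Longrightarrow> ev P x y = 0"
  shows "P = 0"
proof (rule ccontr)
  assume "P \<noteq> 0"
  have "spec y P = 0" if "y \<notin> S" for y
    using assms(2)[OF that] poly_all_0_iff_0[of "spec y P"] by (simp add: ev_def)
  then have "UNIV \<subseteq> S \<union> {y. spec y P = 0}"
    by auto
  then show False
    using finite_spec_eq_0[OF \<open>P \<noteq> 0\<close>] \<open>finite S\<close> infinite_UNIV_char_0[where ?'a = complex]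
    by (meson finite_UnI finite_subset)
qed

lemma cst_simps [simp]:
  "cst 0 = 0" "cst 1 = 1" "cst (a + b) = cst a + cst b" "cst (a * b) = cst a * cst b"
  "cst (a - b) = cst a - cst b" "cst (- a) = - cst a"
proof -
  show "cst 1 = 1"
    unfolding cst_def by (metis one_pCons to_fract_1)
qed (simp_all add: cst_def flip: to_fract_add to_fract_mult to_fract_diff to_fract_uminus)

lemma cst_power [simp]: "cst (a ^ n) = cst a ^ n"
  by (induction n) auto

lemma cst_eq_iff [simp]: "cst a = cst b \<longleftrightarrow> a = b"
  by (simp add: cst_def)

lemma cst_eq_0_iff [simp]: "cst a = 0 \<longleftrightarrow> a = 0"
  using cst_eq_iff[of a 0] by (simp del: cst_eq_iff)

lemma cst_of_nat [simp]: "cst (of_nat n) = of_nat n"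
  by (induction n) auto

lemma cst_inverse: "cst (inverse a) = inverse (cst a)"
proof (cases "a = 0")
  case False
  have "cst a * cst (inverse a) = 1" using False by (simp flip: cst_simps(4))
  then show ?thesis using inverse_unique by fastforce
qed simp

lemma cst_divide [simp]: "cst (a / b) = cst a / cst b"
  by (simp add: divide_inverse cst_inverse)

text \<open>
  Substitution into the coefficients, which are polynomials in \<open>y\<close> alone; it is the coefficient map inside
  \<^const>\<open>poly_subst\<close>, and isolating it lets the homomorphism laws be proved one variable at a time.
\<close>
definition csubst :: "ratmap \<Rightarrow> complex poly \<Rightarrow> ratfun" where
  "csubst f p = poly (map_poly cst p) (snd f)"

lemma csubst_0 [simp]: "csubst f 0 = 0"
  by (simp add: csubst_def)

lemma csubst_pCons [simp]: "csubst f (pCons a p) = cst a + snd f * csubst f p"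
  by (simp add: csubst_def map_poly_pCons)

lemma csubst_add [simp]: "csubst f (p + q) = csubst f p + csubst f q"
  by (induction p q rule: poly_induct2) (simp_all add: algebra_simps)

lemma csubst_smult [simp]: "csubst f (smult a p) = cst a * csubst f p"
  by (induction p) (simp_all add: algebra_simps)

lemma csubst_mult [simp]: "csubst f (p * q) = csubst f p * csubst f q"
  by (induction p) (simp_all add: algebra_simps)

lemma poly_subst_0 [simp]: "poly_subst 0 f = 0"
  by (simp add: poly_subst_def)

lemma poly_subst_pCons [simp]: "poly_subst (pCons p P) f = csubst f p + fst f * poly_subst P f"
  by (simp add: poly_subst_def map_poly_pCons flip: csubst_def)

lemma poly_subst_add [simp]: "poly_subst (P + Q) f = poly_subst P f + poly_subst Q f"
  by (induction P Q rule: poly_induct2) (simp_all add: algebra_simps)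

lemma poly_subst_smult [simp]: "poly_subst (smult p P) f = csubst f p * poly_subst P f"
  by (induction P) (simp_all add: algebra_simps)

lemma poly_subst_mult [simp]: "poly_subst (P * Q) f = poly_subst P f * poly_subst Q f"
  by (induction P) (simp_all add: algebra_simps)

text \<open>
  The image of the map lies on no curve. This is what makes the quotient in \<^const>\<open>rcomp\<close> independent of the
  chosen representation.
\<close>
definition dominant :: "ratmap \<Rightarrow> bool" where
  "dominant f \<longleftrightarrow> (\<forall>P. poly_subst P f = 0 \<longrightarrow> P = 0)"

lemma to_fract_power [simp]: "to_fract (P ^ n) = to_fract P ^ n"
  by (induction n) auto

lemma fract_eq_iff:
  "Q \<noteq> 0 \<Longrightarrow> Q' \<noteq> 0 \<Longrightarrow>
    to_fract P / to_fract Q = to_fract P' / to_fract Q' \<longleftrightarrow> P * Q' = P' * Q"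
  by (simp add: frac_eq_eq flip: to_fract_mult)

text \<open>
  A homogenisation: if \<open>B\<close> is a denominator of the substituted function, a power of \<open>B\<close> turns the result
  into a polynomial, whose values can then be read off pointwise. Points are described by
  \<open>B(x, y) z = C(x, y)\<close>, so that no division occurs.
\<close>
lemma csubst_clear_denominator:
  assumes f: "snd f * to_fract B = to_fract C"
  shows "\<exists>N R. csubst f p * to_fract B ^ N = to_fract R \<and>
    (\<forall>x y z. ev B x y * z = ev C x y \<longrightarrow> ev R x y = ev B x y ^ N * poly p z)"
proof (induction p)
  case 0
  show ?case by (intro exI[of _ 0]) auto
next
  case (pCons a p)
  then obtain N R where R: "csubst f p * to_fract B ^ N = to_fract R"
    "\<And>x y z. ev B x y * z = ev C x y \<Longrightarrow> ev R x y = ev B x y ^ N * poly p z"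
    by blast
  have "csubst f (pCons a p) * to_fract B ^ Suc N
      = cst a * to_fract B ^ Suc N + (snd f * to_fract B) * (csubst f p * to_fract B ^ N)"
    by (simp add: algebra_simps)
  also have "\<dots> = to_fract ([:[:a:]:] * B ^ Suc N + C * R)"
    unfolding R(1) f cst_def by (simp only: to_fract_add to_fract_mult to_fract_power)
  finally have 1: "csubst f (pCons a p) * to_fract B ^ Suc N = to_fract ([:[:a:]:] * B ^ Suc N + C * R)" .
  have 2: "ev ([:[:a:]:] * B ^ Suc N + C * R) x y = ev B x y ^ Suc N * poly (pCons a p) z"
    if "ev B x y * z = ev C x y" for x y z
    using R(2)[OF that] unfolding ev_simps that[symmetric] by (simp add: algebra_simps)
  from 1 2 show ?case by blast
qed

text \<open>
  The same in both variables. It is the bridge from identities in the fraction field to identities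
  between numbers.
\<close>
lemma poly_subst_clear_denominator:
  assumes f: "fst f * to_fract B = to_fract A" "snd f * to_fract B = to_fract C"
  shows "\<exists>N R. poly_subst P f * to_fract B ^ N = to_fract R \<and>
    (\<forall>x y w z. ev B x y * w = ev A x y \<and> ev B x y * z = ev C x y \<longrightarrow>
       ev R x y = ev B x y ^ N * ev P w z)"
proof (induction P)
  case 0
  show ?case by (intro exI[of _ 0]) auto
next
  case (pCons p P)
  then obtain N R where R: "poly_subst P f * to_fract B ^ N = to_fract R"
    "\<And>x y w z. ev B x y * w = ev A x y \<Longrightarrow> ev B x y * z = ev C x y \<Longrightarrow>
       ev R x y = ev B x y ^ N * ev P w z"
    by blast
  obtain N' R' where R': "csubst f p * to_fract B ^ N' = to_fract R'"
    "\<And>x y z. ev B x y * z = ev C x y \<Longrightarrow> ev R' x y = ev B x y ^ N' * poly p z"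
    using csubst_clear_denominator[OF f(2), of p] by blast
  let ?R = "R' * B ^ Suc N + A * R * B ^ N'"
  have "poly_subst (pCons p P) f * to_fract B ^ (Suc N + N')
      = (csubst f p * to_fract B ^ N') * to_fract B ^ Suc N
        + (fst f * to_fract B) * (poly_subst P f * to_fract B ^ N) * to_fract B ^ N'"
    by (simp add: algebra_simps power_add)
  also have "\<dots> = to_fract ?R"
    unfolding R(1) R'(1) f by (simp only: to_fract_add to_fract_mult to_fract_power)
  finally have 1: "poly_subst (pCons p P) f * to_fract B ^ (Suc N + N') = to_fract ?R" .
  have 2: "ev ?R x y = ev B x y ^ (Suc N + N') * ev (pCons p P) w z"
    if "ev B x y * w = ev A x y" "ev B x y * z = ev C x y" for x y w z
    using R(2)[OF that] R'(2)[OF that(2)] unfolding ev_simps that(1)[symmetric]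
    by (simp add: algebra_simps power_add)
  from 1 2 show ?case by blast
qed

text \<open>
  Numerator and denominator need not be in lowest terms. All algebraic laws of composition follow from
  this.
\<close>
lemma rcomp_fract:
  assumes "dominant f" "Q \<noteq> 0"
  shows "(to_fract P / to_fract Q) \<circ>\<^sub>r f = poly_subst P f / poly_subst Q f"
proof -
  let ?V = "to_fract P / to_fract Q"
  let ?P = "fst (quot_of_fract ?V)" and ?Q = "snd (quot_of_fract ?V)"
  have "to_fract ?P / to_fract ?Q = ?V"
    by (metis Fract_conv_to_fract case_prod_unfold quot_to_fract_def quot_to_fract_quot_of_fract)
  moreover have "?Q \<noteq> 0" by simp
  ultimately have "?P * Q = P * ?Q"
    using \<open>Q \<noteq> 0\<close> by (simp add: fract_eq_iff)
  then have "poly_subst ?P f * poly_subst Q f = poly_subst P f * poly_subst ?Q f"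
    by (metis poly_subst_mult)
  moreover have "poly_subst ?Q f \<noteq> 0" "poly_subst Q f \<noteq> 0"
    using assms \<open>?Q \<noteq> 0\<close> by (auto simp: dominant_def)
  ultimately show ?thesis
    by (simp add: rcomp_def frac_eq_eq)
qed

lemma ratfun_cases:
  obtains P Q where "V = to_fract P / to_fract Q" "Q \<noteq> (0 :: complex poly poly)"
  by (metis Fract_cases Fract_conv_to_fract)

lemma rcomp_to_fract: "dominant f \<Longrightarrow> to_fract P \<circ>\<^sub>r f = poly_subst P f"
  by (simp add: rcomp_def) (simp add: one_pCons)

lemma rcomp_cst [simp]: "dominant f \<Longrightarrow> cst c \<circ>\<^sub>r f = cst c"
  by (simp add: rcomp_to_fract cst_def[of c])

lemma rcomp_0 [simp]: "dominant f \<Longrightarrow> 0 \<circ>\<^sub>r f = 0"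
  using rcomp_cst[of f 0] by simp

lemma rcomp_1 [simp]: "dominant f \<Longrightarrow> 1 \<circ>\<^sub>r f = 1"
  using rcomp_cst[of f 1] by simp

lemma rcomp_X [simp]: "dominant f \<Longrightarrow> X \<circ>\<^sub>r f = fst f"
  by (simp add: X_def rcomp_to_fract) (simp add: csubst_def one_pCons map_poly_pCons)

lemma rcomp_Y [simp]: "dominant f \<Longrightarrow> Y \<circ>\<^sub>r f = snd f"
  by (simp add: Y_def rcomp_to_fract)

lemma rcomp_mult [simp]:
  assumes "dominant f"
  shows "(V * W) \<circ>\<^sub>r f = (V \<circ>\<^sub>r f) * (W \<circ>\<^sub>r f)"
proof -
  obtain P Q where V: "V = to_fract P / to_fract Q" "Q \<noteq> 0" by (rule ratfun_cases)
  obtain P' Q' where W: "W = to_fract P' / to_fract Q'" "Q' \<noteq> 0" by (rule ratfun_cases)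
  have "V * W = to_fract (P * P') / to_fract (Q * Q')"
    by (simp add: V W)
  then have "(V * W) \<circ>\<^sub>r f = poly_subst (P * P') f / poly_subst (Q * Q') f"
    using rcomp_fract[OF assms, of "Q * Q'" "P * P'"] V W by simp
  then show ?thesis
    using V W by (simp add: rcomp_fract[OF assms] del: to_fract_mult)
qed

lemma rcomp_add [simp]:
  assumes "dominant f"
  shows "(V + W) \<circ>\<^sub>r f = V \<circ>\<^sub>r f + W \<circ>\<^sub>r f"
proof -
  obtain P Q where V: "V = to_fract P / to_fract Q" "Q \<noteq> 0" by (rule ratfun_cases)
  obtain P' Q' where W: "W = to_fract P' / to_fract Q'" "Q' \<noteq> 0" by (rule ratfun_cases)
  have "V + W = to_fract (P * Q' + P' * Q) / to_fract (Q * Q')"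
    using V(2) W(2) by (simp add: V(1) W(1) add_frac_eq)
  then have "(V + W) \<circ>\<^sub>r f = poly_subst (P * Q' + P' * Q) f / poly_subst (Q * Q') f"
    using rcomp_fract[OF assms, of "Q * Q'" "P * Q' + P' * Q"] V(2) W(2) by simp
  also have "\<dots> = poly_subst P f / poly_subst Q f + poly_subst P' f / poly_subst Q' f"
    using assms V(2) W(2) by (subst add_frac_eq) (auto simp: dominant_def)
  also have "\<dots> = V \<circ>\<^sub>r f + W \<circ>\<^sub>r f"
    using V W by (simp add: rcomp_fract[OF assms])
  finally show ?thesis .
qed

lemma rcomp_uminus [simp]: "dominant f \<Longrightarrow> (- V) \<circ>\<^sub>r f = - (V \<circ>\<^sub>r f)"
  using rcomp_add[of f V "- V"] by (simp add: minus_unique)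

lemma rcomp_diff [simp]: "dominant f \<Longrightarrow> (V - W) \<circ>\<^sub>r f = V \<circ>\<^sub>r f - W \<circ>\<^sub>r f"
  using rcomp_add[of f V "- W"] by simp

lemma rcomp_inverse [simp]:
  assumes "dominant f"
  shows "inverse V \<circ>\<^sub>r f = inverse (V \<circ>\<^sub>r f)"
proof (cases "V = 0")
  case False
  then have "(V \<circ>\<^sub>r f) * (inverse V \<circ>\<^sub>r f) = 1"
    using assms by (simp flip: rcomp_mult)
  then show ?thesis
    by (metis inverse_unique)
qed (use assms in simp)

lemma rcomp_divide [simp]: "dominant f \<Longrightarrow> (V / W) \<circ>\<^sub>r f = (V \<circ>\<^sub>r f) / (W \<circ>\<^sub>r f)"
  by (simp add: divide_inverse)

lemma rcomp_power [simp]: "dominant f \<Longrightarrow> (V ^ n) \<circ>\<^sub>r f = (V \<circ>\<^sub>r f) ^ n"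
  by (induction n) auto

lemma rcomp_of_nat [simp]: "dominant f \<Longrightarrow> of_nat n \<circ>\<^sub>r f = of_nat n"
  by (induction n) auto

lemma rcomp_sum [simp]: "dominant f \<Longrightarrow> (\<Sum>i\<in>A. V i) \<circ>\<^sub>r f = (\<Sum>i\<in>A. V i \<circ>\<^sub>r f)"
  by (induction A rule: infinite_finite_induct) auto

lemma f_map_clear_denominator:
  "\<exists>N R. poly_subst P (f_map \<alpha>\<^sub>0 \<alpha>\<^sub>1 \<beta>\<^sub>0 \<gamma>\<^sub>0) * to_fract [:[:\<gamma>\<^sub>0, 1:]:] ^ N = to_fract R \<and>
    (\<forall>x y. y \<noteq> - \<gamma>\<^sub>0 \<longrightarrow>
      ev R x y = (\<gamma>\<^sub>0 + y) ^ N * ev P (\<alpha>\<^sub>0 + \<alpha>\<^sub>1 * x + y) (\<beta>\<^sub>0 / (\<gamma>\<^sub>0 + y)))"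
proof -
  let ?B = "[:[:\<gamma>\<^sub>0, 1:]:]" and ?A = "[:[:\<alpha>\<^sub>0, 1:], [:\<alpha>\<^sub>1:]:]"
  let ?f = "f_map \<alpha>\<^sub>0 \<alpha>\<^sub>1 \<beta>\<^sub>0 \<gamma>\<^sub>0"
  have *: "to_fract ?B = cst \<gamma>\<^sub>0 + Y" "to_fract ?A = cst \<alpha>\<^sub>0 + cst \<alpha>\<^sub>1 * X + Y"
    by (simp_all add: cst_def X_def Y_def flip: to_fract_add to_fract_mult)
  have "to_fract ?B \<noteq> 0"
    by simp
  then have "cst \<gamma>\<^sub>0 + Y \<noteq> 0"
    unfolding * .
  then have "fst ?f * to_fract ?B = to_fract (?A * ?B)" "snd ?f * to_fract ?B = to_fract [:[:\<beta>\<^sub>0:]:]"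
    unfolding to_fract_mult * by (simp_all add: f_map_def h_map_def cst_def[of \<beta>\<^sub>0])
  from poly_subst_clear_denominator[OF this, of P]
  obtain N R where R: "poly_subst P ?f * to_fract ?B ^ N = to_fract R"
    "\<And>x y w z. ev ?B x y * w = ev (?A * ?B) x y \<Longrightarrow> ev ?B x y * z = ev [:[:\<beta>\<^sub>0:]:] x y \<Longrightarrow>
       ev R x y = ev ?B x y ^ N * ev P w z"
    by blast
  have "ev R x y = (\<gamma>\<^sub>0 + y) ^ N * ev P (\<alpha>\<^sub>0 + \<alpha>\<^sub>1 * x + y) (\<beta>\<^sub>0 / (\<gamma>\<^sub>0 + y))"
    if "y \<noteq> - \<gamma>\<^sub>0" for x y
  proof -
    from that have "\<gamma>\<^sub>0 + y \<noteq> 0"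
      by (simp add: add_eq_0_iff)
    then have "ev ?B x y * (\<beta>\<^sub>0 / (\<gamma>\<^sub>0 + y)) = ev [:[:\<beta>\<^sub>0:]:] x y"
      by simp
    moreover have "ev ?B x y * (\<alpha>\<^sub>0 + \<alpha>\<^sub>1 * x + y) = ev (?A * ?B) x y"
      by (simp add: algebra_simps)
    ultimately show ?thesis
      using R(2) by simp
  qed
  with R(1) show ?thesis by blast
qed

text \<open>
  Every point with \<open>y \<noteq> 0\<close> has a preimage, so a polynomial that vanishes along the image vanishes
  identically.
\<close>
lemma dominant_f_map [simp]:
  assumes "\<alpha>\<^sub>1 \<noteq> 0" "\<beta>\<^sub>0 \<noteq> 0"
  shows "dominant (f_map \<alpha>\<^sub>0 \<alpha>\<^sub>1 \<beta>\<^sub>0 \<gamma>\<^sub>0)"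
  unfolding dominant_def
proof (intro allI impI)
  fix P assume P: "poly_subst P (f_map \<alpha>\<^sub>0 \<alpha>\<^sub>1 \<beta>\<^sub>0 \<gamma>\<^sub>0) = 0"
  obtain N R where R: "poly_subst P (f_map \<alpha>\<^sub>0 \<alpha>\<^sub>1 \<beta>\<^sub>0 \<gamma>\<^sub>0) * to_fract [:[:\<gamma>\<^sub>0, 1:]:] ^ N = to_fract R"
    "\<And>x y. y \<noteq> - \<gamma>\<^sub>0 \<Longrightarrow>
      ev R x y = (\<gamma>\<^sub>0 + y) ^ N * ev P (\<alpha>\<^sub>0 + \<alpha>\<^sub>1 * x + y) (\<beta>\<^sub>0 / (\<gamma>\<^sub>0 + y))"
    using f_map_clear_denominator by blast
  have "R = 0"
    using R(1) P by simp
  show "P = 0"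
  proof (rule zero_if_ev_zero[of "{0}"])
    fix x y :: complex assume "y \<notin> {0}"
    let ?y = "\<beta>\<^sub>0 / y - \<gamma>\<^sub>0"
    let ?x = "(x - \<alpha>\<^sub>0 - ?y) / \<alpha>\<^sub>1"
    have "?y \<noteq> - \<gamma>\<^sub>0" "\<gamma>\<^sub>0 + ?y \<noteq> 0" "\<beta>\<^sub>0 / (\<gamma>\<^sub>0 + ?y) = y" "\<alpha>\<^sub>0 + \<alpha>\<^sub>1 * ?x + ?y = x"
      using assms \<open>y \<notin> {0}\<close> by auto
    then show "ev P x y = 0"
      using R(2)[of ?y ?x] \<open>R = 0\<close> by simp
  qed simp
qed

text \<open>
  An identity \<open>P(f) U = Q(f) V\<close> of rational functions holds at every point where \<open>f\<close> is defined, with no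
  further exceptions from the denominators of its terms.
\<close>
lemma f_map_identity_at_points:
  assumes "\<alpha>\<^sub>1 \<noteq> 0" "\<beta>\<^sub>0 \<noteq> 0"
    and "poly_subst P (f_map \<alpha>\<^sub>0 \<alpha>\<^sub>1 \<beta>\<^sub>0 \<gamma>\<^sub>0) * to_fract U = poly_subst Q (f_map \<alpha>\<^sub>0 \<alpha>\<^sub>1 \<beta>\<^sub>0 \<gamma>\<^sub>0) * to_fract V"
    and "y \<noteq> - \<gamma>\<^sub>0"
  shows "ev P (\<alpha>\<^sub>0 + \<alpha>\<^sub>1 * x + y) (\<beta>\<^sub>0 / (\<gamma>\<^sub>0 + y)) * ev U x y
    = ev Q (\<alpha>\<^sub>0 + \<alpha>\<^sub>1 * x + y) (\<beta>\<^sub>0 / (\<gamma>\<^sub>0 + y)) * ev V x y"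
proof -
  let ?f = "f_map \<alpha>\<^sub>0 \<alpha>\<^sub>1 \<beta>\<^sub>0 \<gamma>\<^sub>0" and ?B = "[:[:\<gamma>\<^sub>0, 1:]:]"
  obtain N R where R: "poly_subst P ?f * to_fract ?B ^ N = to_fract R"
    "\<And>x y. y \<noteq> - \<gamma>\<^sub>0 \<Longrightarrow>
      ev R x y = (\<gamma>\<^sub>0 + y) ^ N * ev P (\<alpha>\<^sub>0 + \<alpha>\<^sub>1 * x + y) (\<beta>\<^sub>0 / (\<gamma>\<^sub>0 + y))"
    using f_map_clear_denominator by blast
  obtain M S where S: "poly_subst Q ?f * to_fract ?B ^ M = to_fract S"
    "\<And>x y. y \<noteq> - \<gamma>\<^sub>0 \<Longrightarrow>
      ev S x y = (\<gamma>\<^sub>0 + y) ^ M * ev Q (\<alpha>\<^sub>0 + \<alpha>\<^sub>1 * x + y) (\<beta>\<^sub>0 / (\<gamma>\<^sub>0 + y))"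
    using f_map_clear_denominator by blast
  have "to_fract (R * U * ?B ^ M) = (poly_subst P ?f * to_fract U) * to_fract ?B ^ N * to_fract ?B ^ M"
    by (simp only: to_fract_mult to_fract_power R(1)[symmetric]) (simp only: ac_simps)
  also have "\<dots> = to_fract (S * V * ?B ^ N)"
    unfolding assms(3) by (simp only: to_fract_mult to_fract_power S(1)[symmetric]) (simp only: ac_simps)
  finally have "R * U * ?B ^ M = S * V * ?B ^ N"
    by (simp only: to_fract_eq_iff)
  then have "ev (R * U * ?B ^ M) x y = ev (S * V * ?B ^ N) x y"
    by simp
  then have "(\<gamma>\<^sub>0 + y) ^ (N + M) * (ev P (\<alpha>\<^sub>0 + \<alpha>\<^sub>1 * x + y) (\<beta>\<^sub>0 / (\<gamma>\<^sub>0 + y)) * ev U x y)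
    = (\<gamma>\<^sub>0 + y) ^ (N + M) * (ev Q (\<alpha>\<^sub>0 + \<alpha>\<^sub>1 * x + y) (\<beta>\<^sub>0 / (\<gamma>\<^sub>0 + y)) * ev V x y)"
    using assms(4) by (simp add: R(2) S(2) power_add mult_ac)
  moreover have "\<gamma>\<^sub>0 + y \<noteq> 0"
    using assms(4) by (simp add: add_eq_0_iff)
  ultimately show ?thesis by simp
qed

lemma dominant_translation [simp]: "dominant (translation a 0)"
  unfolding dominant_def
proof (intro allI impI)
  fix P assume P: "poly_subst P (translation a 0) = 0"
  have *: "fst (translation a 0) * to_fract 1 = to_fract [:[:a:], 1:]"
    "snd (translation a 0) * to_fract 1 = to_fract [:[:0, 1:]:]"
    by (simp_all add: translation_def X_def Y_def)
      (simp add: cst_def flip: to_fract_add)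
  obtain N R where R: "poly_subst P (translation a 0) * to_fract 1 ^ N = to_fract R"
    "\<And>x y w z. ev 1 x y * w = ev [:[:a:], 1:] x y \<Longrightarrow> ev 1 x y * z = ev [:[:0, 1:]:] x y \<Longrightarrow>
       ev R x y = ev 1 x y ^ N * ev P w z"
    using poly_subst_clear_denominator[OF *, of P] by blast
  have "R = 0"
    using R(1) P by simp
  show "P = 0"
    by (rule zero_if_ev_zero[of "{}"]) (use R(2)[of "x - a" y x y for x y] \<open>R = 0\<close> in auto)
qed

section \<open>Rational functions of y alone and their fibres\<close>

text \<open>
  The subfield \<open>\<complex>(y)\<close>.
\<close>
definition yfield :: "ratfun set" where
  "yfield = {to_fract [:p:] / to_fract [:q:] | p q. q \<noteq> 0}"

lemma yfieldI: "q \<noteq> 0 \<Longrightarrow> to_fract [:p:] / to_fract [:q:] \<in> yfield"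
  by (auto simp: yfield_def)

lemma yfieldE:
  assumes "V \<in> yfield"
  obtains p q where "V = to_fract [:p:] / to_fract [:q:]" "q \<noteq> 0"
  using assms by (auto simp: yfield_def)

lemma yfield_mult [intro]: "V \<in> yfield \<Longrightarrow> W \<in> yfield \<Longrightarrow> V * W \<in> yfield"
proof (elim yfieldE)
  fix p q p' q' :: "complex poly" assume "q \<noteq> 0" "q' \<noteq> 0"
  then show "V * W \<in> yfield" if "V = to_fract [:p:] / to_fract [:q:]" "W = to_fract [:p':] / to_fract [:q':]"
    using that yfieldI[of "q * q'" "p * p'"] by (simp add: mult.commute flip: to_fract_mult)
qed

lemma yfield_add [intro]: "V \<in> yfield \<Longrightarrow> W \<in> yfield \<Longrightarrow> V + W \<in> yfield"
proof (elim yfieldE)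
  fix p q p' q' :: "complex poly" assume "q \<noteq> 0" "q' \<noteq> 0"
  then show "V + W \<in> yfield" if "V = to_fract [:p:] / to_fract [:q:]" "W = to_fract [:p':] / to_fract [:q':]"
    using that yfieldI[of "q * q'" "p * q' + p' * q"]
    by (simp add: add_frac_eq mult.commute flip: to_fract_mult to_fract_add)
qed

lemma yfield_inverse [intro]: "V \<in> yfield \<Longrightarrow> inverse V \<in> yfield"
proof (elim yfieldE)
  fix p q :: "complex poly" assume "q \<noteq> 0"
  then show "inverse V \<in> yfield" if "V = to_fract [:p:] / to_fract [:q:]"
    using that yfieldI[of p q] yfieldI[of 1 0] by (cases "p = 0") auto
qed

lemma yfield_cst [intro]: "cst c \<in> yfield"
  using yfieldI[of 1 "[:c:]"] by (simp add: cst_def flip: one_pCons)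

lemma yfield_Y [intro]: "Y \<in> yfield"
  using yfieldI[of 1 "[:0, 1:]"] by (simp add: Y_def flip: one_pCons)

lemma yfield_0 [intro]: "0 \<in> yfield"
  using yfield_cst[of 0] by simp

lemma yfield_uminus [intro]: "V \<in> yfield \<Longrightarrow> - V \<in> yfield"
  using yfield_mult[OF yfield_cst[of "-1"]] by fastforce

lemma yfield_diff [intro]: "V \<in> yfield \<Longrightarrow> W \<in> yfield \<Longrightarrow> V - W \<in> yfield"
  by (metis diff_conv_add_uminus yfield_add yfield_uminus)

lemma yfield_divide [intro]: "V \<in> yfield \<Longrightarrow> W \<in> yfield \<Longrightarrow> V / W \<in> yfield"
  by (metis divide_inverse yfield_inverse yfield_mult)

lemma yfield_sum [intro]: "(\<And>i. i \<in> A \<Longrightarrow> V i \<in> yfield) \<Longrightarrow> sum V A \<in> yfield"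
  by (induction A rule: infinite_finite_induct) auto

lemma degree_eq_if_fract_in_yfield:
  assumes "to_fract P / to_fract Q \<in> yfield" "P \<noteq> 0" "Q \<noteq> 0"
  shows "degree P = degree Q"
proof -
  obtain p q where pq: "to_fract P / to_fract Q = to_fract [:p:] / to_fract [:q:]" "q \<noteq> 0"
    using assms(1) by (rule yfieldE)
  then have "P * [:q:] = [:p:] * Q"
    using assms(3) pq(2) fract_eq_iff[of Q "[:q:]" P "[:p:]"] by simp
  moreover have "p \<noteq> 0"
    using pq assms by auto
  ultimately show ?thesis
    using degree_mult_eq[of P "[:q:]"] degree_mult_eq[of "[:p:]" Q] pq(2) assms by simp
qed

lemma X_notin_yfield: "X \<notin> yfield"
  using degree_eq_if_fract_in_yfield[of "[:0, 1:]" 1] by (auto simp: X_def)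

lemma fract_quot_of_fract: "to_fract (fst (quot_of_fract V)) / to_fract (snd (quot_of_fract V)) = V"
  by (metis Fract_conv_to_fract case_prod_unfold quot_to_fract_def quot_to_fract_quot_of_fract)

text \<open>
  In a reduced fraction each part divides the corresponding part of any other representation, so it is
  free of \<open>x\<close> as well.
\<close>
lemma degree_quot_of_fract_yfield:
  assumes "V \<in> yfield"
  shows "degree (fst (quot_of_fract V)) = 0" "degree (snd (quot_of_fract V)) = 0"
proof -
  let ?P = "fst (quot_of_fract V)" and ?Q = "snd (quot_of_fract V)"
  obtain p q where pq: "V = to_fract [:p:] / to_fract [:q:]" "q \<noteq> 0"
    using assms by (rule yfieldE)
  have "?Q \<noteq> 0" by simp
  have eq: "?P * [:q:] = [:p:] * ?Q"
    using \<open>?Q \<noteq> 0\<close> pq fract_quot_of_fract[of V] fract_eq_iff[of ?Q "[:q:]" ?P "[:p:]"] by simp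
  have "coprime ?P ?Q"
    by (rule coprime_quot_of_fract)
  then have "?Q dvd [:q:]"
    using eq by (metis coprime_commute coprime_dvd_mult_right_iff dvd_triv_right)
  then show "degree ?Q = 0"
    using pq(2) dvd_imp_degree_le[of ?Q "[:q:]"] by simp
  then have "degree (?P * [:q:]) = 0"
    unfolding eq using degree_mult_le[of "[:p:]" ?Q] by simp
  then show "degree ?P = 0"
    using pq(2) by (cases "?P = 0") (auto simp: degree_mult_eq)
qed

text \<open>
  A vanishing member of the pencil would express the numerator as a constant multiple of the denominator.
\<close>
lemma pencil_member_nonzero:
  assumes "nonconstant V" "(a, b) \<noteq> (0, 0)"
  shows "[:[:a:]:] * fst (quot_of_fract V) + [:[:b:]:] * snd (quot_of_fract V) \<noteq> 0"
proof
  let ?P = "fst (quot_of_fract V)" and ?Q = "snd (quot_of_fract V)"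
  have "to_fract ?Q \<noteq> 0" by simp
  assume "[:[:a:]:] * ?P + [:[:b:]:] * ?Q = 0"
  then have "to_fract ([:[:a:]:] * ?P + [:[:b:]:] * ?Q) = 0"
    by (simp only: to_fract_0)
  then have *: "cst a * to_fract ?P + cst b * to_fract ?Q = 0"
    unfolding cst_def by (simp only: to_fract_add to_fract_mult)
  show False
  proof (cases "a = 0")
    case True
    then show False using * assms(2) \<open>to_fract ?Q \<noteq> 0\<close> by auto
  next
    case False
    then have "cst a \<noteq> 0" by simp
    then have "to_fract ?P = cst (- b / a) * to_fract ?Q"
      using * by (simp add: field_simps add_eq_0_iff) 
    then have "V = cst (- b / a)"
      using fract_quot_of_fract[of V] \<open>to_fract ?Q \<noteq> 0\<close> by (metis nonzero_mult_div_cancel_right)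
    then show False
      using assms(1) unfolding nonconstant_def by blast
  qed
qed

lemma irreducible_factor_of_positive_degree:
  fixes F :: "complex poly poly"
  assumes "degree F > 0"
  obtains R where "irreducible R" "R dvd F" "degree R > 0"
proof -
  have "degree F > 0 \<longrightarrow> (\<exists>R. irreducible R \<and> R dvd F \<and> degree R > 0)"
  proof (induction F rule: prime_divisors_induct)
    case (unit F)
    then show ?case by (auto simp: is_unit_poly_iff)
  next
    case (factor p F)
    show ?case
    proof (intro impI)
      assume *: "degree (p * F) > 0"
      show "\<exists>R. irreducible R \<and> R dvd p * F \<and> degree R > 0"
      proof (cases "degree p > 0")
        case True
        moreover have "irreducible p"
          using factor(1) by (intro prime_elem_imp_irreducible) simp
        ultimately show ?thesis by (meson dvd_triv_left)
      next
        case False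
        then have "degree F > 0"
          using * degree_mult_le[of p F] by simp
        then show ?thesis using factor by auto
      qed
    qed
  qed simp
  then show ?thesis
    using assms that by blast
qed

text \<open>
  Every member of the pencil is a nonzero polynomial in \<open>y\<close>, so its factors are lines \<open>y = c\<close>; and each such
  line occurs, because the numerator and the denominator have no common zero and thus one of their
  combinations vanishes at \<open>c\<close>. The right-hand side does not depend on \<open>V\<close>: all these functions have the same
  fibres.
\<close>
lemma fibres_yfield:
  assumes "V \<in> yfield" "nonconstant V"
  shows "fibres V = {R. irreducible R \<and> degree R = 0}"
proof (intro set_eqI iffI; clarsimp)
  let ?P = "fst (quot_of_fract V)" and ?Q = "snd (quot_of_fract V)"
  note deg = degree_quot_of_fract_yfield[OF assms(1)]
  fix R :: "complex poly poly"
  {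
    assume "R \<in> fibres V"
    then obtain a b where ab: "irreducible R" "(a, b) \<noteq> (0, 0)" "R dvd [:[:a:]:] * ?P + [:[:b:]:] * ?Q"
      unfolding fibres_def by blast
    have "degree ([:[:a:]:] * ?P + [:[:b:]:] * ?Q) = 0"
      using deg degree_mult_le[of "[:[:a:]:]" ?P] degree_mult_le[of "[:[:b:]:]" ?Q]
        degree_add_le[of "[:[:a:]:] * ?P" 0 "[:[:b:]:] * ?Q"] by simp
    then show "irreducible R \<and> degree R = 0"
      using ab dvd_imp_degree_le[OF ab(3) pencil_member_nonzero[OF assms(2) ab(2)]] by simp
  next
    assume R: "irreducible R" "degree R = 0"
    then obtain r where r: "R = [:r:]"
      by (metis degree_0_id degree_eq_zeroE)
    have "r \<noteq> 0"
      using R r by auto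
    have "degree r \<noteq> 0"
    proof
      assume "degree r = 0"
      then obtain c where "r = [:c:]" "c \<noteq> 0"
        using \<open>r \<noteq> 0\<close> by (metis degree_eq_zeroE pCons_eq_0_iff)
      then have "R * [:[:1 / c:]:] = 1"
        using r by (simp add: one_pCons)
      then have "R dvd 1"
        by (metis dvdI)
      then show False using R(1) by (simp add: irreducible_def)
    qed
    then obtain c where c: "poly r c = 0"
      using fundamental_theorem_of_algebra[of r] constant_degree[of r] by auto
    obtain p q where pq: "?P = [:p:]" "?Q = [:q:]"
      using deg by (metis degree_eq_zeroE)
    \<comment> \<open>The irreducible \<open>R\<close> is associated to the linear factor of its root \<open>c\<close>.\<close>
    let ?l = "[:[:- c, 1:]:]"
    have "?l dvd R"
      using c r by (metis const_poly_dvd_const_poly_iff poly_eq_0_iff_dvd)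
    then obtain s where s: "R = ?l * s" by (elim dvdE)
    have "\<not> ?l dvd 1"
      by (auto simp: is_unit_const_poly_iff is_unit_poly_iff)
    then have "s dvd 1"
      using R(1) s by (metis irreducibleD)
    then have "R dvd ?l"
      unfolding s by (simp only: mult_unit_dvd_iff dvd_refl)
    \<comment> \<open>The member of the pencil through the line \<open>y = c\<close>.\<close>
    have nz: "(poly q c, - poly p c) \<noteq> (0, 0)"
    proof
      assume "(poly q c, - poly p c) = (0, 0)"
      then have "[:- c, 1:] dvd p" "[:- c, 1:] dvd q"
        by (simp_all add: poly_eq_0_iff_dvd)
      then have "?l dvd ?P" "?l dvd ?Q"
        using pq by simp_all
      then show False
        using \<open>\<not> ?l dvd 1\<close> coprime_quot_of_fract[of V] coprime_common_divisor by blast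
    qed
    have "[:- c, 1:] dvd [:poly q c:] * p + [:- poly p c:] * q"
      by (simp flip: poly_eq_0_iff_dvd)
    then have "?l dvd [:[:poly q c:]:] * ?P + [:[:- poly p c:]:] * ?Q"
      unfolding pq by simp
    with \<open>R dvd ?l\<close> have "R dvd [:[:poly q c:]:] * ?P + [:[:- poly p c:]:] * ?Q"
      by (rule dvd_trans)
    then show "R \<in> fibres V"
      unfolding fibres_def using R(1) nz by blast
  }
qed

text \<open>
  The numerator or the denominator involves \<open>x\<close>, and both are members of the pencil.
\<close>
lemma fibre_of_positive_degree:
  assumes "V \<notin> yfield"
  obtains R where "R \<in> fibres V" "degree R > 0"
proof -
  let ?P = "fst (quot_of_fract V)" and ?Q = "snd (quot_of_fract V)"
  have pos: "degree ?P > 0 \<or> degree ?Q > 0"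
  proof (rule ccontr)
    assume "\<not> ?thesis"
    then obtain p q where "?P = [:p:]" "?Q = [:q:]"
      by (metis degree_eq_zeroE neq0_conv)
    moreover have "?Q \<noteq> 0" by simp
    ultimately have "V \<in> yfield"
      using yfieldI[of q p] fract_quot_of_fract[of V] by simp
    with assms show False ..
  qed
  consider (numerator) "degree ?P > 0" | (denominator) "degree ?Q > 0"
    using pos by metis
  then show ?thesis
  proof cases
    case numerator
    then obtain R where "irreducible R" "R dvd ?P" "degree R > 0"
      by (rule irreducible_factor_of_positive_degree)
    moreover have "?P = [:[:1:]:] * ?P + [:[:0:]:] * ?Q"
      by (simp flip: one_pCons)
    ultimately show ?thesis
      using that[of R] unfolding fibres_def by (metis (mono_tags, lifting) Pair_inject mem_Collect_eq zero_neq_one)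
  next
    case denominator
    then obtain R where "irreducible R" "R dvd ?Q" "degree R > 0"
      by (rule irreducible_factor_of_positive_degree)
    moreover have "?Q = [:[:0:]:] * ?P + [:[:1:]:] * ?Q"
      by (simp flip: one_pCons)
    ultimately show ?thesis
      using that[of R] unfolding fibres_def by (metis (mono_tags, lifting) Pair_inject mem_Collect_eq zero_neq_one)
  qed
qed

lemma nonconstant_if_notin_yfield: "V \<notin> yfield \<Longrightarrow> nonconstant V"
  by (auto simp: nonconstant_def)

lemma same_fibration_yfield:
  "V \<in> yfield \<Longrightarrow> nonconstant V \<Longrightarrow> W \<in> yfield \<Longrightarrow> nonconstant W \<Longrightarrow> same_fibration V W"
  by (simp add: same_fibration_def fibres_yfield)

lemma not_same_fibration_yfield:
  assumes "V \<notin> yfield" "W \<in> yfield" "nonconstant W"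
  shows "\<not> same_fibration V W"
  using fibre_of_positive_degree[OF assms(1)] fibres_yfield[OF assms(2,3)]
  unfolding same_fibration_def by (metis (mono_tags, lifting) less_irrefl mem_Collect_eq)

section \<open>The iterates of the Moebius map\<close>

text \<open>
  With the matrix of \<open>h\<close>, the \<open>n\<close>-th power is \<open>U\<^sub>n\<close> times that matrix plus \<open>b U\<^sub>n\<^sub>-\<^sub>1\<close> times the identity, where
  \<open>U\<^sub>n\<close> is this Lucas sequence. Thus \<open>h\<^sup>n\<close> is the identity exactly when \<open>U\<^sub>n = 0\<close>.
\<close>
fun lucas :: "complex \<Rightarrow> complex \<Rightarrow> nat \<Rightarrow> complex" where
  "lucas b g 0 = 0"
| "lucas b g (Suc 0) = 1"
| "lucas b g (Suc (Suc n)) = g * lucas b g (Suc n) + b * lucas b g n"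


lemma lucas_consecutive:
  assumes "b \<noteq> 0"
  shows "lucas b g j \<noteq> 0 \<or> lucas b g (Suc j) \<noteq> 0"
  by (induction j) (use assms in auto)

lemma cst_Y_affine_eq_0_iff: "cst a * Y + cst c = 0 \<longleftrightarrow> a = 0 \<and> c = 0"
proof -
  have "cst a * Y + cst c = to_fract [:[:c, a:]:]"
    by (simp add: cst_def Y_def flip: to_fract_add to_fract_mult)
  then show ?thesis by auto
qed

lemma h_iter_0 [simp]: "h_iter b g 0 = Y"
  by (simp add: h_iter_def)

lemma h_iter_Suc: "h_iter b g (Suc j) = h_map b g (h_iter b g j)"
  by (simp add: h_iter_def)

lemma h_iter_eq:
  assumes "b \<noteq> 0"
  shows "h_iter b g (Suc j) = cst b * (cst (lucas b g j) * Y + cst (lucas b g (Suc j))) /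
    (cst (lucas b g (Suc j)) * Y + cst (lucas b g (Suc (Suc j))))"
proof (induction j)
  case 0
  show ?case by (simp add: h_iter_Suc h_map_def add.commute)
next
  case (Suc j)
  let ?N = "cst (lucas b g j) * Y + cst (lucas b g (Suc j))"
  let ?D = "cst (lucas b g (Suc j)) * Y + cst (lucas b g (Suc (Suc j)))"
  let ?E = "cst (lucas b g (Suc (Suc j))) * Y + cst (lucas b g (Suc (Suc (Suc j))))"
  have "?D \<noteq> 0"
    unfolding cst_Y_affine_eq_0_iff using lucas_consecutive[OF assms] by blast
  have "cst g * ?D + cst b * ?N = ?E"
    unfolding lucas.simps(3) cst_simps by (simp only: ring_distribs mult_ac add_ac)
  then have "cst g + cst b * ?N / ?D = ?E / ?D"
    using \<open>?D \<noteq> 0\<close> by (metis add_divide_eq_iff)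
  then show ?case
    unfolding h_iter_Suc[of b g "Suc j"] Suc.IH h_map_def by (simp only: divide_divide_eq_right)
qed

text \<open>
  The difference of the two cross products is \<open>U\<^sub>j\<^sub>+\<^sub>1 (y\<^sup>2 + g y - b)\<close>; the quadratic factor is the fixed
  point equation of \<open>h\<close>.
\<close>
lemma h_iter_eq_Y_iff:
  assumes "b \<noteq> 0"
  shows "h_iter b g (Suc j) = Y \<longleftrightarrow> lucas b g (Suc j) = 0"
proof -
  let ?N = "cst (lucas b g j) * Y + cst (lucas b g (Suc j))"
  let ?D = "cst (lucas b g (Suc j)) * Y + cst (lucas b g (Suc (Suc j)))"
  have "?D \<noteq> 0"
    unfolding cst_Y_affine_eq_0_iff using lucas_consecutive[OF assms] by blast
  have "h_iter b g (Suc j) = Y \<longleftrightarrow> Y * ?D - cst b * ?N = 0"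
    unfolding h_iter_eq[OF assms] nonzero_divide_eq_eq[OF \<open>?D \<noteq> 0\<close>] right_minus_eq by (rule eq_commute)
  also have "Y * ?D - cst b * ?N = cst (lucas b g (Suc j)) * (Y * Y + cst g * Y - cst b)"
    unfolding lucas.simps(3) cst_simps by (simp only: ring_distribs mult_ac add_ac) (simp add: algebra_simps)
  also have "\<dots> = 0 \<longleftrightarrow> lucas b g (Suc j) = 0"
  proof -
    have "Y * Y + cst g * Y - cst b = to_fract [:[:- b, g, 1:]:]"
      by (simp add: cst_def Y_def flip: to_fract_add to_fract_mult to_fract_diff)
    then show ?thesis
      by simp
  qed
  finally show ?thesis .
qed

lemma lucas_nonzero_if_not_periodic:
  assumes "b \<noteq> 0" "\<not> periodic b g" "j \<ge> 1"
  shows "lucas b g j \<noteq> 0"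
proof
  assume "lucas b g j = 0"
  then have "h_iter b g j = Y"
    using h_iter_eq_Y_iff[OF assms(1), of g "j - 1"] assms(3) by simp
  define k where "k = (LEAST k. k \<ge> 1 \<and> h_iter b g k = Y)"
  have "k \<ge> 1 \<and> h_iter b g k = Y"
    unfolding k_def by (rule LeastI[of _ j]) (use \<open>h_iter b g j = Y\<close> assms(3) in simp)
  moreover have "h_iter b g i \<noteq> Y" if "1 \<le> i" "i < k" for i
    using that not_less_Least[of i "\<lambda>k. k \<ge> 1 \<and> h_iter b g k = Y"] by (auto simp: k_def)
  ultimately have "k_periodic b g k"
    by (simp add: k_periodic_def)
  with assms(2) show False
    by (auto simp: periodic_def)
qed

lemma lucas_nonzero_below_period:
  assumes "b \<noteq> 0" "k_periodic b g k" "1 \<le> j" "j < k"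
  shows "lucas b g j \<noteq> 0"
  using h_iter_eq_Y_iff[OF assms(1), of g "j - 1"] assms(2-) by (auto simp: k_periodic_def)

lemma h_iter_yfield [intro]: "h_iter b g j \<in> yfield"
  by (induction j) (auto simp: h_iter_Suc h_map_def)

text \<open>
  The rational functions of \<open>y\<close> without a pole at \<open>y = \<infinity>\<close>.
\<close>
definition finite_at_infinity :: "ratfun set" where
  "finite_at_infinity = {to_fract [:p:] / to_fract [:q:] | p q. q \<noteq> 0 \<and> degree p \<le> degree q}"

lemma finite_at_infinityI:
  "q \<noteq> 0 \<Longrightarrow> degree p \<le> degree q \<Longrightarrow> to_fract [:p:] / to_fract [:q:] \<in> finite_at_infinity"
  by (auto simp: finite_at_infinity_def)

lemma finite_at_infinity_cst: "cst c \<in> finite_at_infinity"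
  using finite_at_infinityI[of 1 "[:c:]"] by (simp add: cst_def flip: one_pCons)

lemma finite_at_infinity_add:
  assumes "V \<in> finite_at_infinity" "W \<in> finite_at_infinity"
  shows "V + W \<in> finite_at_infinity"
proof -
  obtain p q where V: "V = to_fract [:p:] / to_fract [:q:]" "q \<noteq> 0" "degree p \<le> degree q"
    using assms(1) by (auto simp: finite_at_infinity_def)
  obtain p' q' where W: "W = to_fract [:p':] / to_fract [:q':]" "q' \<noteq> 0" "degree p' \<le> degree q'"
    using assms(2) by (auto simp: finite_at_infinity_def)
  have "V + W = to_fract [:p * q' + p' * q:] / to_fract [:q * q':]"
    using V(2) W(2) by (simp add: V(1) W(1) add_frac_eq mult.commute flip: to_fract_mult to_fract_add)
  moreover have "degree (p * q') \<le> degree q + degree q'" "degree (p' * q) \<le> degree q + degree q'"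
    using degree_mult_le[of p q'] degree_mult_le[of p' q] V(3) W(3) by linarith+
  ultimately show ?thesis
    using finite_at_infinityI[of "q * q'" "p * q' + p' * q"] V(2) W(2)
    by (simp add: degree_mult_eq degree_add_le)
qed

lemma finite_at_infinity_mult:
  assumes "V \<in> finite_at_infinity" "W \<in> finite_at_infinity"
  shows "V * W \<in> finite_at_infinity"
proof -
  obtain p q where V: "V = to_fract [:p:] / to_fract [:q:]" "q \<noteq> 0" "degree p \<le> degree q"
    using assms(1) by (auto simp: finite_at_infinity_def)
  obtain p' q' where W: "W = to_fract [:p':] / to_fract [:q':]" "q' \<noteq> 0" "degree p' \<le> degree q'"
    using assms(2) by (auto simp: finite_at_infinity_def)
  have "V * W = to_fract [:p * p':] / to_fract [:q * q':]"
    by (simp add: V(1) W(1) mult.commute flip: to_fract_mult)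
  then show ?thesis
    using finite_at_infinityI[of "q * q'" "p * p'"] V(2,3) W(2,3) degree_mult_le[of p p']
    by (simp add: degree_mult_eq)
qed

lemma finite_at_infinity_sum:
  "(\<And>i. i \<in> A \<Longrightarrow> V i \<in> finite_at_infinity) \<Longrightarrow> sum V A \<in> finite_at_infinity"
  using finite_at_infinity_cst[of 0]
  by (induction A rule: infinite_finite_induct) (auto intro: finite_at_infinity_add)

lemma Y_notin_finite_at_infinity: "Y \<notin> finite_at_infinity"
proof
  assume "Y \<in> finite_at_infinity"
  then obtain p q where pq: "Y = to_fract [:p:] / to_fract [:q:]" "q \<noteq> 0" "degree p \<le> degree q"
    by (auto simp: finite_at_infinity_def)
  then have "to_fract [:[:0, 1:] * q:] = to_fract [:p:]"
    by (simp add: Y_def field_simps flip: to_fract_mult)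
  then have "[:0, 1:] * q = p"
    by (simp only: to_fract_eq_iff pCons_eq_iff)
  then have "degree p = Suc (degree q)"
    using pq(2) degree_mult_eq[of "[:0, 1:]" q] by simp
  then show False
    using pq(3) by simp
qed

text \<open>
  \<open>U\<^sub>j\<^sub>+\<^sub>1\<close> is the coefficient of \<open>y\<close> in the denominator of \<open>h\<^sup>j\<^sup>+\<^sup>1(y)\<close>: as long as it is nonzero, the iterate
  does not fix infinity.
\<close>
lemma h_iter_finite_at_infinity:
  assumes "b \<noteq> 0" "lucas b g (Suc j) \<noteq> 0"
  shows "h_iter b g (Suc j) \<in> finite_at_infinity"
proof -
  have "h_iter b g (Suc j) = to_fract [:[:b * lucas b g (Suc j), b * lucas b g j:]:] /
      to_fract [:[:lucas b g (Suc (Suc j)), lucas b g (Suc j):]:]"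
    unfolding h_iter_eq[OF assms(1)] cst_def Y_def by (simp add: mult_ac flip: to_fract_add to_fract_mult)
  then show ?thesis
    using assms(2) finite_at_infinityI[of "[:lucas b g (Suc (Suc j)), lucas b g (Suc j):]"
        "[:b * lucas b g (Suc j), b * lucas b g j:]"] by (simp del: lucas.simps)
qed

text \<open>
  No iterate strictly between \<open>0\<close> and the period fixes infinity, so the pole of the first term at
  \<open>y = \<infinity>\<close> cannot cancel.
\<close>
lemma nonconstant_iterate_sum:
  assumes "b \<noteq> 0" "k_periodic b g k" "c 0 \<noteq> 0"
  shows "nonconstant (\<Sum>j<k. cst (c j) * h_iter b g j)"
  unfolding nonconstant_def
proof
  obtain m where m: "k = Suc m"
    using assms(2) by (cases k) (auto simp: k_periodic_def)
  let ?S = "\<Sum>j<m. cst (c (Suc j)) * h_iter b g (Suc j)"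
  have sum: "(\<Sum>j<k. cst (c j) * h_iter b g j) = cst (c 0) * Y + ?S"
    by (simp only: m sum.lessThan_Suc_shift h_iter_0)
  have "lucas b g (Suc j) \<noteq> 0" if "j < m" for j
    using lucas_nonzero_below_period[OF assms(1,2), of "Suc j"] that m by simp
  then have "?S \<in> finite_at_infinity"
    by (intro finite_at_infinity_sum finite_at_infinity_mult finite_at_infinity_cst
        h_iter_finite_at_infinity assms(1)) auto
  assume "(\<Sum>j<k. cst (c j) * h_iter b g j) \<in> range cst"
  then obtain d where "cst (c 0) * Y + ?S = cst d"
    unfolding sum by blast
  then have eq: "cst d + cst (- 1) * ?S = cst (c 0) * Y"
    by (simp only: cst_simps mult_minus_left mult_1_left flip: diff_conv_add_uminus)
      (simp only: diff_eq_eq)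
  have "cst (1 / c 0) * (cst d + cst (- 1) * ?S) = Y"
    unfolding eq using assms(3) by simp
  moreover have "cst (1 / c 0) * (cst d + cst (- 1) * ?S) \<in> finite_at_infinity"
    using \<open>?S \<in> finite_at_infinity\<close>
    by (intro finite_at_infinity_add finite_at_infinity_mult finite_at_infinity_cst)
  ultimately have "Y \<in> finite_at_infinity"
    by (rule subst)
  then show False
    using Y_notin_finite_at_infinity by blast
qed

section \<open>Semi-invariant functions for a periodic Moebius map\<close>

lemma fst_f_map [simp]: "fst (f_map \<alpha>\<^sub>0 \<alpha> \<beta> \<gamma>) = cst \<alpha>\<^sub>0 + cst \<alpha> * X + Y"
  and snd_f_map [simp]: "snd (f_map \<alpha>\<^sub>0 \<alpha> \<beta> \<gamma>) = h_map \<beta> \<gamma> Y"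
  by (simp_all add: f_map_def)

lemma rcomp_h_map [simp]: "dominant f \<Longrightarrow> h_map \<beta> \<gamma> V \<circ>\<^sub>r f = h_map \<beta> \<gamma> (V \<circ>\<^sub>r f)"
  by (simp add: h_map_def)

lemma h_iter_rcomp_f_map:
  assumes "dominant (f_map \<alpha>\<^sub>0 \<alpha> \<beta> \<gamma>)"
  shows "h_iter \<beta> \<gamma> j \<circ>\<^sub>r f_map \<alpha>\<^sub>0 \<alpha> \<beta> \<gamma> = h_iter \<beta> \<gamma> (Suc j)"
  by (induction j) (simp_all add: assms h_iter_Suc)

lemma h_iter_rcomp_translation: "h_iter \<beta> \<gamma> j \<circ>\<^sub>r translation a 0 = h_iter \<beta> \<gamma> j"
  by (induction j) (simp_all add: h_iter_Suc, simp add: translation_def)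

definition geometric_orbit_sum :: "complex \<Rightarrow> complex \<Rightarrow> complex \<Rightarrow> nat \<Rightarrow> ratfun" where
  "geometric_orbit_sum \<alpha> \<beta> \<gamma> k = (\<Sum>j<k. cst (\<alpha> ^ (k - 1 - j)) * h_iter \<beta> \<gamma> j)"

definition weighted_orbit_sum :: "complex \<Rightarrow> complex \<Rightarrow> complex \<Rightarrow> nat \<Rightarrow> ratfun" where
  "weighted_orbit_sum \<alpha> \<beta> \<gamma> k =
     (\<Sum>j<k - 1. of_nat (k - 1 - j) * cst (\<alpha> ^ (k - 1 - j)) * h_iter \<beta> \<gamma> j)"

lemma geometric_orbit_sum_yfield [intro]: "geometric_orbit_sum \<alpha> \<beta> \<gamma> k \<in> yfield"
  unfolding geometric_orbit_sum_def by (intro yfield_sum yfield_mult yfield_cst h_iter_yfield)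

lemma weighted_orbit_sum_yfield [intro]: "weighted_orbit_sum \<alpha> \<beta> \<gamma> k \<in> yfield"
  unfolding weighted_orbit_sum_def cst_of_nat[symmetric]
  by (intro yfield_sum yfield_mult yfield_cst h_iter_yfield)

lemma geometric_orbit_sum_rcomp_translation:
  "geometric_orbit_sum \<alpha> \<beta> \<gamma> k \<circ>\<^sub>r translation a 0 = geometric_orbit_sum \<alpha> \<beta> \<gamma> k"
  by (simp add: geometric_orbit_sum_def h_iter_rcomp_translation flip: cst_power)

lemma weighted_orbit_sum_rcomp_translation:
  "weighted_orbit_sum \<alpha> \<beta> \<gamma> k \<circ>\<^sub>r translation a 0 = weighted_orbit_sum \<alpha> \<beta> \<gamma> k"
  by (simp add: weighted_orbit_sum_def h_iter_rcomp_translation flip: cst_power)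

text \<open>
  Composition shifts the orbit by one step. The term that leaves the range of summation returns as \<open>y\<close> by
  periodicity, and the missing first term has weight \<open>\<alpha>\<^sup>k\<close>. The slope \<open>\<delta>\<close> of the first coordinate is
  independent of \<open>\<alpha>\<close>, so that \<open>\<alpha> = 1\<close> covers the first integral.
\<close>
lemma geometric_orbit_sum_rcomp:
  assumes "dominant (f_map \<alpha>\<^sub>0 \<delta> \<beta> \<gamma>)" "k_periodic \<beta> \<gamma> k"
  shows "geometric_orbit_sum \<alpha> \<beta> \<gamma> k \<circ>\<^sub>r f_map \<alpha>\<^sub>0 \<delta> \<beta> \<gamma> =
    cst \<alpha> * geometric_orbit_sum \<alpha> \<beta> \<gamma> k + cst (1 - \<alpha> ^ k) * Y"
proof -
  obtain m where m: "k = Suc m" "h_iter \<beta> \<gamma> (Suc m) = Y"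
    using assms(2) by (cases k) (auto simp: k_periodic_def)
  let ?S = "\<Sum>j<m. cst (\<alpha> ^ (m - j)) * h_iter \<beta> \<gamma> (Suc j)"
  have "geometric_orbit_sum \<alpha> \<beta> \<gamma> k \<circ>\<^sub>r f_map \<alpha>\<^sub>0 \<delta> \<beta> \<gamma>
      = (\<Sum>j<Suc m. cst (\<alpha> ^ (m - j)) * h_iter \<beta> \<gamma> (Suc j))"
    unfolding geometric_orbit_sum_def m(1) using assms(1)
    by (simp add: h_iter_rcomp_f_map del: sum.lessThan_Suc cst_power)
  also have "\<dots> = ?S + Y"
    using m(2) by simp
  finally have 1: "geometric_orbit_sum \<alpha> \<beta> \<gamma> k \<circ>\<^sub>r f_map \<alpha>\<^sub>0 \<delta> \<beta> \<gamma> = ?S + Y" .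
  have "cst \<alpha> * geometric_orbit_sum \<alpha> \<beta> \<gamma> k = (\<Sum>j<Suc m. cst (\<alpha> ^ (Suc m - j)) * h_iter \<beta> \<gamma> j)"
    unfolding geometric_orbit_sum_def m(1) sum_distrib_left
    by (intro sum.cong refl) (simp add: Suc_diff_le mult.assoc)
  also have "\<dots> = ?S + cst (\<alpha> ^ k) * Y"
    unfolding m(1) sum.lessThan_Suc_shift by simp
  finally show ?thesis
    unfolding 1 by (simp add: algebra_simps)
qed

text \<open>
  The shift lowers each weight \<open>k - 1 - j\<close> by one, and the geometric sum makes up for the difference.
\<close>
lemma weighted_orbit_sum_rcomp:
  assumes "dominant (f_map \<alpha>\<^sub>0 \<alpha> \<beta> \<gamma>)" "k_periodic \<beta> \<gamma> k"
  shows "weighted_orbit_sum \<alpha> \<beta> \<gamma> k \<circ>\<^sub>r f_map \<alpha>\<^sub>0 \<alpha> \<beta> \<gamma> =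
    cst \<alpha> * (weighted_orbit_sum \<alpha> \<beta> \<gamma> k + geometric_orbit_sum \<alpha> \<beta> \<gamma> k)
      - of_nat k * cst (\<alpha> ^ k) * Y"
proof -
  obtain m where m: "k = Suc m" "h_iter \<beta> \<gamma> (Suc m) = Y"
    using assms(2) by (cases k) (auto simp: k_periodic_def)
  let ?S = "\<Sum>j<m. of_nat (m - j) * cst (\<alpha> ^ (m - j)) * h_iter \<beta> \<gamma> (Suc j)"
  have 1: "weighted_orbit_sum \<alpha> \<beta> \<gamma> k \<circ>\<^sub>r f_map \<alpha>\<^sub>0 \<alpha> \<beta> \<gamma> = ?S"
    unfolding weighted_orbit_sum_def m(1) using assms(1)
    by (simp add: h_iter_rcomp_f_map del: sum.lessThan_Suc cst_power)
  have "weighted_orbit_sum \<alpha> \<beta> \<gamma> k = (\<Sum>j<Suc m. of_nat (m - j) * cst (\<alpha> ^ (m - j)) * h_iter \<beta> \<gamma> j)"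
    unfolding weighted_orbit_sum_def m(1) by simp
  then have "cst \<alpha> * (weighted_orbit_sum \<alpha> \<beta> \<gamma> k + geometric_orbit_sum \<alpha> \<beta> \<gamma> k)
      = (\<Sum>j<Suc m. of_nat (Suc m - j) * cst (\<alpha> ^ (Suc m - j)) * h_iter \<beta> \<gamma> j)"
    unfolding geometric_orbit_sum_def m(1)
    by (simp only: sum_distrib_left sum.distrib[symmetric])
      (intro sum.cong refl, simp add: Suc_diff_le algebra_simps)
  also have "\<dots> = ?S + of_nat k * cst (\<alpha> ^ k) * Y"
    unfolding m(1) sum.lessThan_Suc_shift by simp
  finally show ?thesis
    unfolding 1 by (simp only: add_diff_cancel_right')
qed

lemma nonconstant_geometric_orbit_sum:
  assumes "\<alpha> \<noteq> 0" "\<beta> \<noteq> 0" "k_periodic \<beta> \<gamma> k"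
  shows "nonconstant (geometric_orbit_sum \<alpha> \<beta> \<gamma> k)"
  unfolding geometric_orbit_sum_def
  by (rule nonconstant_iterate_sum) (use assms in auto)

lemma H1_eq: "H1 \<beta> \<gamma> k = geometric_orbit_sum 1 \<beta> \<gamma> k"
  by (simp add: H1_def geometric_orbit_sum_def)

lemma first_integral_H1:
  assumes "dominant (f_map \<alpha>\<^sub>0 \<alpha> \<beta> \<gamma>)" "\<beta> \<noteq> 0" "k_periodic \<beta> \<gamma> k"
  shows "first_integral (f_map \<alpha>\<^sub>0 \<alpha> \<beta> \<gamma>) (H1 \<beta> \<gamma> k)"
  using geometric_orbit_sum_rcomp[OF assms(1,3), of 1]
    nonconstant_geometric_orbit_sum[of 1, OF _ assms(2,3)]
  by (simp add: first_integral_def H1_eq)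

lemma linear_in_X_notin_yfield:
  assumes "c \<noteq> 0" "R \<in> yfield" "S \<in> yfield" "S \<noteq> 0"
  shows "(cst c * X + R) / S \<notin> yfield"
proof
  assume *: "(cst c * X + R) / S \<in> yfield"
  have "X = ((cst c * X + R) / S * S - R) / cst c"
    using assms by simp
  then have "X \<in> yfield"
    using * assms by (metis yfield_cst yfield_diff yfield_divide yfield_mult)
  then show False
    using X_notin_yfield by blast
qed

text \<open>
  Comparing degrees in \<open>x\<close>: the numerator has degree \<open>n\<close> and the denominator has degree \<open>0\<close>.
\<close>
lemma power_linear_in_X_notin_yfield:
  assumes "c \<noteq> 0" "R \<in> yfield" "n > 0"
  shows "(cst c * X + R) ^ n \<notin> yfield"
proof -
  obtain p q where R: "R = to_fract [:p:] / to_fract [:q:]" "q \<noteq> 0"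
    using assms(2) by (rule yfieldE)
  let ?P = "[:p, smult c q:]"
  have "cst c * X + R = to_fract ?P / to_fract [:q:]"
    using R(2) by (simp add: R(1) cst_def X_def add_divide_eq_iff field_simps flip: to_fract_add to_fract_mult)
  then have eq: "(cst c * X + R) ^ n = to_fract (?P ^ n) / to_fract ([:q:] ^ n)"
    by (simp add: power_divide)
  have "?P \<noteq> 0" "degree ?P = 1"
    using assms(1) R(2) by auto
  then have "degree (?P ^ n) = n" "degree ([:q:] ^ n) = 0"
    by (simp_all add: degree_power_eq R(2))
  then show ?thesis
    using degree_eq_if_fract_in_yfield[of "?P ^ n" "[:q:] ^ n"] assms(3) R(2) \<open>?P \<noteq> 0\<close>
    unfolding eq by (metis less_irrefl pCons_eq_0_iff power_not_zero)
qed

text \<open>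
  The condition on \<open>\<alpha>\<^sub>0\<close> says that \<open>x = a\<close> is fixed by \<open>x \<mapsto> \<alpha>\<^sub>0 + \<alpha> x\<close>. With this parameter one computation
  covers both the normalised map (\<open>a = 0\<close>) and the original one.
\<close>
lemma eigenfunction_rcomp:
  assumes "dominant (f_map \<alpha>\<^sub>0 \<alpha> \<beta> \<gamma>)" "k_periodic \<beta> \<gamma> k" and \<alpha>\<^sub>0: "\<alpha>\<^sub>0 = a * (1 - \<alpha>)"
  defines "V \<equiv> cst (\<alpha> ^ k - 1) * (X - cst a) + geometric_orbit_sum \<alpha> \<beta> \<gamma> k"
  shows "V \<circ>\<^sub>r f_map \<alpha>\<^sub>0 \<alpha> \<beta> \<gamma> = cst \<alpha> * V"
proof -
  have "cst \<alpha>\<^sub>0 = cst a * (1 - cst \<alpha>)"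
    by (simp add: \<alpha>\<^sub>0)
  then show ?thesis
    unfolding V_def using assms(1)
    by (simp add: geometric_orbit_sum_rcomp[OF assms(1,2)] del: cst_power) (simp add: algebra_simps)
qed

text \<open>
  The denominator is an eigenfunction with eigenvalue \<open>\<alpha>\<close>, and the numerator goes to \<open>\<alpha> (N + D)\<close>. Two choices
  satisfy the conditions on the shift \<open>a\<close> and the constant \<open>e\<close>: for \<open>\<alpha> \<noteq> 1\<close> one takes \<open>e = 0\<close> and the
  fixed point \<open>a\<close> of \<open>x \<mapsto> \<alpha>\<^sub>0 + \<alpha> x\<close>; for \<open>\<alpha> = 1\<close> one takes \<open>a = 0\<close> and \<open>e = k \<alpha>\<^sub>0\<close>.
\<close>
lemma translating_function_rcomp:
  assumes "dominant (f_map \<alpha>\<^sub>0 \<alpha> \<beta> \<gamma>)" "\<alpha> \<noteq> 0" "\<beta> \<noteq> 0" "k_periodic \<beta> \<gamma> k" "\<alpha> ^ k = 1"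
    and e: "\<alpha> * e = e" "of_nat k * (\<alpha>\<^sub>0 - a + \<alpha> * a) = \<alpha> * e"
  defines "N \<equiv> of_nat k * (X - cst a) + weighted_orbit_sum \<alpha> \<beta> \<gamma> k"
    and "D \<equiv> cst e + geometric_orbit_sum \<alpha> \<beta> \<gamma> k"
  shows "D \<noteq> 0" "(N / D) \<circ>\<^sub>r f_map \<alpha>\<^sub>0 \<alpha> \<beta> \<gamma> = N / D + 1"
proof -
  show "D \<noteq> 0"
  proof
    assume "D = 0"
    then have "geometric_orbit_sum \<alpha> \<beta> \<gamma> k = cst (- e)"
      by (simp add: D_def add_eq_0_iff)
    then show False
      using nonconstant_geometric_orbit_sum[OF assms(2-4)] unfolding nonconstant_def by blast
  qed
  have D: "D \<circ>\<^sub>r f_map \<alpha>\<^sub>0 \<alpha> \<beta> \<gamma> = cst \<alpha> * D"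
    unfolding D_def using assms(1) e(1)
    by (simp add: geometric_orbit_sum_rcomp[OF assms(1,4)] assms(5) ring_distribs del: cst_power flip: cst_simps(4))
  have e': "of_nat k * (cst \<alpha>\<^sub>0 - cst a + cst \<alpha> * cst a) = cst \<alpha> * cst e"
    using arg_cong[OF e(2), of cst] by simp
  have "N \<circ>\<^sub>r f_map \<alpha>\<^sub>0 \<alpha> \<beta> \<gamma>
      = of_nat k * (cst \<alpha>\<^sub>0 - cst a + cst \<alpha> * cst a) + of_nat k * cst \<alpha> * (X - cst a)
        + cst \<alpha> * (weighted_orbit_sum \<alpha> \<beta> \<gamma> k + geometric_orbit_sum \<alpha> \<beta> \<gamma> k)"
    unfolding N_def using assms(1)
    by (simp add: weighted_orbit_sum_rcomp[OF assms(1,4)] assms(5) del: cst_power) (simp add: algebra_simps)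
  also have "\<dots> = cst \<alpha> * (N + D)"
    unfolding e' N_def D_def by (simp add: algebra_simps)
  finally show "(N / D) \<circ>\<^sub>r f_map \<alpha>\<^sub>0 \<alpha> \<beta> \<gamma> = N / D + 1"
    using assms(1,2) \<open>D \<noteq> 0\<close> by (simp add: D add_divide_distrib)
qed

section \<open>Unboundedness along the orbit of infinity\<close>

text \<open>
  D'Ocagne's identity: the left-hand side is multiplied by \<open>- b\<close> when \<open>i\<close> grows by one.
\<close>
lemma lucas_dOcagne:
  "lucas b g (n + i) * lucas b g (Suc i) - lucas b g (Suc (n + i)) * lucas b g i = (- b) ^ i * lucas b g n"
proof (induction i)
  case (Suc i)
  have "lucas b g (n + Suc i) * lucas b g (Suc (Suc i)) - lucas b g (Suc (n + Suc i)) * lucas b g (Suc i)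
      = (- b) * (lucas b g (n + i) * lucas b g (Suc i) - lucas b g (Suc (n + i)) * lucas b g i)"
    by (simp add: ring_distribs mult_ac)
  also have "\<dots> = (- b) ^ Suc i * lucas b g n"
    unfolding Suc.IH by simp
  finally show ?case .
qed simp

text \<open>
  By d'Ocagne's identity two equal ratios at distance \<open>n\<close> force \<open>U\<^sub>n = 0\<close>. Both halves of the orbit of
  infinity consist of such ratios, so they are infinite.
\<close>
lemma lucas_ratio_inj:
  assumes "b \<noteq> 0" and nz: "\<And>j. j \<ge> 1 \<Longrightarrow> lucas b g j \<noteq> 0"
  shows "inj (\<lambda>j. lucas b g (Suc j) / lucas b g (Suc (Suc j)))"
proof -
  have *: "i = j" if "i \<le> j" and eq: "lucas b g (Suc i) / lucas b g (Suc (Suc i)) = lucas b g (Suc j) / lucas b g (Suc (Suc j))" for i j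
  proof (rule ccontr)
    assume "i \<noteq> j"
    define n where "n = j - i"
    have n: "Suc j = n + Suc i" "n \<ge> 1"
      using that(1) \<open>i \<noteq> j\<close> by (auto simp: n_def)
    have "lucas b g (Suc (Suc i)) \<noteq> 0" "lucas b g (Suc (Suc j)) \<noteq> 0"
      by (rule nz, simp)+
    then have "lucas b g (Suc i) * lucas b g (Suc (Suc j)) = lucas b g (Suc j) * lucas b g (Suc (Suc i))"
      using eq by (simp only: frac_eq_eq simp_thms)
    then have "(- b) ^ Suc i * lucas b g n = 0"
      unfolding lucas_dOcagne[symmetric] n(1) by (simp only: right_minus_eq mult.commute)
    then show False
      using nz[OF n(2)] assms(1) by simp
  qed
  show ?thesis
  proof (rule injI)
    fix i j
    assume "lucas b g (Suc i) / lucas b g (Suc (Suc i)) = lucas b g (Suc j) / lucas b g (Suc (Suc j))"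
    then show "i = j"
      using *[of i j] *[of j i] by (cases "i \<le> j") auto
  qed
qed

lemma Bfun_add:
  fixes u v :: "'a \<Rightarrow> complex"
  assumes "Bfun u F" "Bfun v F"
  shows "Bfun (\<lambda>z. u z + v z) F"
proof -
  obtain A B where "eventually (\<lambda>z. norm (u z) \<le> A) F" "eventually (\<lambda>z. norm (v z) \<le> B) F"
    using assms unfolding Bfun_def by blast
  then have "eventually (\<lambda>z. norm (u z + v z) \<le> A + B) F"
    by eventually_elim (rule order_trans[OF norm_triangle_ineq add_mono])
  then show ?thesis by (rule BfunI)
qed

lemma Bfun_cmult:
  fixes u :: "'a \<Rightarrow> complex"
  assumes "Bfun u F"
  shows "Bfun (\<lambda>z. c * u z) F"
proof -
  obtain A where "eventually (\<lambda>z. norm (u z) \<le> A) F"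
    using assms unfolding Bfun_def by blast
  then have "eventually (\<lambda>z. norm (c * u z) \<le> norm c * A) F"
    by eventually_elim (simp add: norm_mult mult_left_mono)
  then show ?thesis by (rule BfunI)
qed

lemma Bfun_cong:
  fixes u v :: "'a \<Rightarrow> complex"
  assumes "eventually (\<lambda>z. u z = v z) F" "Bfun u F"
  shows "Bfun v F"
proof -
  obtain A where "eventually (\<lambda>z. norm (u z) \<le> A) F"
    using assms(2) unfolding Bfun_def by blast
  with assms(1) have "eventually (\<lambda>z. norm (v z) \<le> A) F"
    by eventually_elim auto
  then show ?thesis by (rule BfunI)
qed

lemma Bfun_compose:
  fixes u :: "'a \<Rightarrow> complex"
  assumes "Bfun u G" "filterlim h G F"
  shows "Bfun (\<lambda>z. u (h z)) F"
proof -
  obtain A where "eventually (\<lambda>z. norm (u z) \<le> A) G"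
    using assms(1) unfolding Bfun_def by blast
  then show ?thesis
    using assms(2) by (intro BfunI[of _ A]) (auto simp: filterlim_iff)
qed

lemma Bfun_tendsto:
  fixes u :: "'a \<Rightarrow> complex"
  assumes "(u \<longlongrightarrow> l) F"
  shows "Bfun u F"
proof (rule BfunI)
  have "eventually (\<lambda>z. dist (u z) l < 1) F"
    using assms by (rule tendstoD) simp
  then show "eventually (\<lambda>z. norm (u z) \<le> norm l + 1) F"
  proof eventually_elim
    case (elim z)
    then show ?case using norm_triangle_ineq2[of "u z" l] by (simp add: dist_norm)
  qed
qed

text \<open>
  Boundedness is transported by \<open>v \<circ> h = a v + r\<close> wherever \<open>r\<close> is bounded. Stating this for filters covers
  finite points, the pole of \<open>h\<close> and the point at infinity at once.
\<close>
lemma Bfun_semiconj_iff: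
  fixes v r :: "complex \<Rightarrow> complex"
  assumes eq: "eventually (\<lambda>y. v (h y) = a * v y + r y) F" and "a \<noteq> 0" "Bfun r F"
    and h: "filterlim h G F" and h': "filterlim h' F G" "eventually (\<lambda>w. h (h' w) = w) G"
  shows "Bfun v F \<longleftrightarrow> Bfun v G"
proof
  assume "Bfun v G"
  then have "Bfun (\<lambda>y. v (h y)) F"
    using h by (rule Bfun_compose)
  then have "Bfun (\<lambda>y. (1 / a) * (v (h y) + (- 1) * r y)) F"
    using assms(3) by (intro Bfun_cmult Bfun_add)
  then show "Bfun v F"
    by (rule Bfun_cong[rotated]) (use eq in eventually_elim, use \<open>a \<noteq> 0\<close> in simp)
next
  assume "Bfun v F"
  then have "Bfun (\<lambda>y. a * v y + r y) F"
    using assms(3) by (intro Bfun_cmult Bfun_add)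
  then have "Bfun (\<lambda>y. v (h y)) F"
    by (rule Bfun_cong[rotated]) (use eq in eventually_elim, simp)
  then have "Bfun (\<lambda>w. v (h (h' w))) G"
    using h'(1) by (rule Bfun_compose)
  then show "Bfun v G"
    by (rule Bfun_cong[rotated]) (use h'(2) in eventually_elim, simp)
qed

lemma eventually_at_if_cofinite:
  assumes "eventually P cofinite"
  shows "eventually P (at (z :: 'a :: t1_space))"
proof -
  let ?S = "{x. \<not> P x} - {z}"
  have "finite ?S"
    using assms by (simp add: eventually_cofinite)
  then have "open (- ?S)"
    by (intro open_Compl finite_imp_closed)
  then show ?thesis
    unfolding eventually_at_topological by (intro exI[of _ "- ?S"]) auto
qed

lemma eventually_at_infinity_if_cofinite:
  assumes "eventually P cofinite"
  shows "eventually P (at_infinity :: 'a :: real_normed_vector filter)"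
proof -
  let ?B = "Max (insert 0 (norm ` {x. \<not> P x}))"
  have "finite (norm ` {x. \<not> P x})"
    using assms by (simp add: eventually_cofinite)
  then have "norm x \<le> ?B" if "\<not> P x" for x
    using that by (intro Max_ge) auto
  then show ?thesis
    unfolding eventually_at_infinity by (intro exI[of _ "?B + 1"]) force
qed

lemma ex_notin_finite_if_inj:
  fixes f :: "nat \<Rightarrow> 'a"
  assumes "inj f" "finite S"
  shows "\<exists>J. f J \<notin> S"
proof (rule ccontr)
  assume "\<not> ?thesis"
  then have "range f \<subseteq> S"
    by auto
  then show False
    using range_inj_infinite[OF \<open>inj f\<close>] finite_subset \<open>finite S\<close> by auto
qed

text \<open>
  For \<open>b \<noteq> 0\<close> the assumption on the Lucas sequence says that \<open>h(y) = b / (g + y)\<close> is not periodic.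
\<close>
locale moebius_orbit =
  fixes b g :: complex
  assumes b: "b \<noteq> 0" and lucas_nz: "j \<ge> 1 \<Longrightarrow> lucas b g j \<noteq> 0"
begin

definition h :: "complex \<Rightarrow> complex" where "h y = b / (g + y)"
definition h' :: "complex \<Rightarrow> complex" where "h' w = b / w - g"

lemma h_h': "w \<noteq> 0 \<Longrightarrow> h (h' w) = w"
  using b by (simp add: h_def h'_def)

lemma h'_h: "y \<noteq> - g \<Longrightarrow> h' (h y) = y"
  using b by (simp add: h_def h'_def)

lemma h_nonzero: "y \<noteq> - g \<Longrightarrow> h y \<noteq> 0"
  using b by (auto simp: h_def add_eq_0_iff)

lemma filterlim_h:
  assumes "z \<noteq> - g"
  shows "filterlim h (at (h z)) (at z)"
proof (rule filterlim_atI)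
  have "g + z \<noteq> 0"
    using assms by (simp add: add_eq_0_iff)
  then show "(h \<longlongrightarrow> h z) (at z)"
    unfolding h_def by (intro tendsto_intros)
  have "eventually (\<lambda>y. y \<noteq> - g) (at z)" "eventually (\<lambda>y. y \<noteq> z) (at z)"
    by (rule eventually_at_if_cofinite, simp add: eventually_cofinite)+
  then show "eventually (\<lambda>y. h y \<noteq> h z) (at z)"
    by eventually_elim (metis assms h'_h)
qed

lemma filterlim_h':
  assumes "w \<noteq> 0"
  shows "filterlim h' (at (h' w)) (at w)"
proof (rule filterlim_atI)
  show "(h' \<longlongrightarrow> h' w) (at w)"
    unfolding h'_def using assms by (intro tendsto_intros)
  have "eventually (\<lambda>y. y \<noteq> 0) (at w)" "eventually (\<lambda>y. y \<noteq> w) (at w)"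
    by (rule eventually_at_if_cofinite, simp add: eventually_cofinite)+
  then show "eventually (\<lambda>y. h' y \<noteq> h' w) (at w)"
    by eventually_elim (metis assms h_h')
qed

lemma filterlim_h_pole: "filterlim h at_infinity (at (- g))"
proof -
  have "filterlim (\<lambda>y. g + y) (at 0) (at (- g))"
    by (rule filterlim_atI) (auto intro!: tendsto_eq_intros simp: eventually_at_filter add_eq_0_iff)
  then show ?thesis
    unfolding h_def using b
    by (intro filterlim_divide_at_infinity[where c = b] tendsto_intros) auto
qed

lemma filterlim_h_infinity: "filterlim h (at 0) at_infinity"
proof (rule filterlim_atI)
  show "(h \<longlongrightarrow> 0) at_infinity"
    unfolding h_def
    by (intro tendsto_divide_0[OF tendsto_const] tendsto_add_filterlim_at_infinity[OF tendsto_const] filterlim_ident)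
  show "eventually (\<lambda>y. h y \<noteq> 0) at_infinity"
    using eventually_not_equal_at_infinity[of "- g"] by eventually_elim (rule h_nonzero)
qed

lemma filterlim_h'_infinity: "filterlim h' (at (- g)) at_infinity"
proof (rule filterlim_atI)
  have "((\<lambda>w. b / w - g) \<longlongrightarrow> 0 - g) at_infinity"
    by (intro tendsto_intros tendsto_divide_0[OF tendsto_const] filterlim_ident)
  then show "(h' \<longlongrightarrow> - g) at_infinity"
    by (simp add: h'_def[abs_def])
  show "eventually (\<lambda>w. h' w \<noteq> - g) at_infinity"
    using eventually_not_equal_at_infinity[of 0] by eventually_elim (simp add: h'_def b)
qed

text \<open>
  The forward orbit \<open>h(\<infinity>) = 0, h\<^sup>2(\<infinity>), \<dots>\<close> and the backward orbit
  \<open>h\<^sup>-\<^sup>1(\<infinity>) = - g, h\<^sup>-\<^sup>2(\<infinity>), \<dots>\<close> of infinity, in closed form.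
\<close>
definition fwd :: "nat \<Rightarrow> complex" where "fwd j = b * (lucas b g j / lucas b g (Suc j))"
definition bwd :: "nat \<Rightarrow> complex" where "bwd j = - (lucas b g (Suc (Suc j)) / lucas b g (Suc j))"

lemma fwd_0: "fwd 0 = 0" by (simp add: fwd_def)

lemma bwd_0: "bwd 0 = - g" by (simp add: bwd_def)

lemma h_fwd: "fwd j \<noteq> - g" "h (fwd j) = fwd (Suc j)"
proof -
  have nz: "lucas b g (Suc j) \<noteq> 0" "lucas b g (Suc (Suc j)) \<noteq> 0"
    by (rule lucas_nz, simp)+
  have "g + fwd j = lucas b g (Suc (Suc j)) / lucas b g (Suc j)"
    unfolding fwd_def lucas.simps(3) using nz(1) by (simp only: add_divide_distrib) simp
  then have *: "g + fwd j \<noteq> 0" "h (fwd j) = fwd (Suc j)"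
    using nz by (simp_all only: h_def fwd_def divide_eq_0_iff divide_divide_eq_right) simp_all
  from *(1) show "fwd j \<noteq> - g"
    by auto
  from *(2) show "h (fwd j) = fwd (Suc j)" .
qed

lemma h_bwd: "bwd (Suc j) \<noteq> - g" "h (bwd (Suc j)) = bwd j"
proof -
  have nz: "lucas b g (Suc j) \<noteq> 0" "lucas b g (Suc (Suc j)) \<noteq> 0"
    by (rule lucas_nz, simp)+
  have *: "g + bwd (Suc j) = - (b * lucas b g (Suc j) / lucas b g (Suc (Suc j)))"
    unfolding bwd_def lucas.simps(3)[of b g "Suc j"] using nz(2)
    by (simp only: add_divide_distrib) simp
  then have "g + bwd (Suc j) \<noteq> 0"
    using nz b by (simp only: neg_equal_0_iff_equal divide_eq_0_iff mult_eq_0_iff) simp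
  then show "bwd (Suc j) \<noteq> - g"
    by auto
  show "h (bwd (Suc j)) = bwd j"
    unfolding h_def * using nz b by (simp add: bwd_def del: lucas.simps)
qed

lemma inj_fwd: "inj (\<lambda>j. fwd (Suc j))"
proof (rule injI)
  fix i j assume "fwd (Suc i) = fwd (Suc j)"
  then have "lucas b g (Suc i) / lucas b g (Suc (Suc i)) = lucas b g (Suc j) / lucas b g (Suc (Suc j))"
    unfolding fwd_def using b by (simp only: mult_cancel_left simp_thms)
  then show "i = j"
    using lucas_ratio_inj[OF b lucas_nz] unfolding inj_def by blast
qed

lemma inj_bwd: "inj bwd"
  using lucas_ratio_inj[OF b lucas_nz] unfolding inj_def bwd_def
  by (metis inverse_divide neg_equal_iff_equal)

text \<open>
  If \<open>v\<close> were unbounded at one point of a half orbit, it would be so at all of them, which are infinitely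
  many. The half orbit \<^const>\<open>bwd\<close> starts at the pole \<open>- g\<close> of \<open>h\<close>, whose image is infinity; this gives the last claim.
  The hypothesis on \<open>S\<close> holds for rational functions, which have finitely many poles.
\<close>
lemma bounded_on_orbit:
  fixes v s :: "complex \<Rightarrow> complex"
  assumes "finite S" and S: "\<And>z. z \<notin> S \<Longrightarrow> Bfun v (at z)"
    and eq: "eventually (\<lambda>y. v (h y) = a * v y + s y) cofinite" and "a \<noteq> 0"
    and s: "\<And>j. Bfun s (at (fwd j))" "\<And>j. Bfun s (at (bwd j))"
  shows "Bfun v (at (fwd j))" "Bfun v (at (bwd j))" "Bfun v at_infinity"
proof -
  have at: "eventually (\<lambda>y. v (h y) = a * v y + s y) (at z)" for z
    using eq by (rule eventually_at_if_cofinite)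
  have step: "Bfun v (at z) \<longleftrightarrow> Bfun v (at (h z))" if "z \<noteq> - g" "Bfun s (at z)" for z
  proof (rule Bfun_semiconj_iff[where v = v and h = h and a = a and r = s and h' = h',
        OF at \<open>a \<noteq> 0\<close> that(2) filterlim_h[OF that(1)]])
    show "filterlim h' (at z) (at (h z))"
      using filterlim_h'[of "h z"] h'_h h_nonzero that(1) by simp
    have "eventually (\<lambda>w. w \<noteq> 0) (at (h z))"
      by (rule eventually_at_if_cofinite) (simp add: eventually_cofinite)
    then show "eventually (\<lambda>w. h (h' w) = w) (at (h z))"
      by eventually_elim (rule h_h')
  qed
  have fwd_step: "Bfun v (at (fwd (Suc i))) \<longleftrightarrow> Bfun v (at (fwd i))" for i
    using step[OF h_fwd(1)[of i] s(1)[of i]] unfolding h_fwd(2) by (rule sym)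
  have bwd_step: "Bfun v (at (bwd (Suc i))) \<longleftrightarrow> Bfun v (at (bwd i))" for i
    using step[OF h_bwd(1)[of i] s(2)[of "Suc i"]] unfolding h_bwd(2) .
  have fwd_iff: "Bfun v (at (fwd i)) \<longleftrightarrow> Bfun v (at (fwd 0))" for i
    by (induction i) (simp_all only: fwd_step)
  have bwd_iff: "Bfun v (at (bwd i)) \<longleftrightarrow> Bfun v (at (bwd 0))" for i
    by (induction i) (simp_all only: bwd_step)
  obtain J where "fwd (Suc J) \<notin> S"
    using ex_notin_finite_if_inj[OF inj_fwd \<open>finite S\<close>] by auto
  then show "Bfun v (at (fwd j))"
    using S[of "fwd (Suc J)"] unfolding fwd_iff[of j] fwd_iff[of "Suc J"] by simp
  obtain J where "bwd J \<notin> S"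
    using ex_notin_finite_if_inj[OF inj_bwd \<open>finite S\<close>] by auto
  then have "Bfun v (at (bwd 0))"
    using S[of "bwd J"] unfolding bwd_iff[of J] by simp
  then show "Bfun v (at (bwd j))"
    unfolding bwd_iff[of j] .
  have "Bfun v (at (- g))"
    using \<open>Bfun v (at (bwd 0))\<close> unfolding bwd_0 .
  moreover have "Bfun v (at (- g)) \<longleftrightarrow> Bfun v at_infinity"
  proof (rule Bfun_semiconj_iff[where v = v and h = h and a = a and r = s and h' = h',
        OF at \<open>a \<noteq> 0\<close> _ filterlim_h_pole filterlim_h'_infinity])
    show "Bfun s (at (- g))"
      using s(2)[of 0] by (simp add: bwd_0)
    show "eventually (\<lambda>w. h (h' w) = w) at_infinity"
      using eventually_not_equal_at_infinity[of 0] by eventually_elim (rule h_h')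
  qed
  ultimately show "Bfun v at_infinity" by blast
qed

text \<open>
  Since \<open>v\<close> is bounded on the whole orbit of infinity, so is \<open>T\<close>. Near infinity \<open>T(h(y))\<close> is bounded because \<open>h(y)\<close>
  tends to \<open>0\<close>; solving the equation for \<open>y\<close> would then bound \<open>y\<close>.
\<close>
lemma no_rational_solution:
  fixes T v :: "complex \<Rightarrow> complex"
  assumes "finite S"
    and T: "\<And>z. z \<notin> S \<Longrightarrow> Bfun T (at z)" and v: "\<And>z. z \<notin> S \<Longrightarrow> Bfun v (at z)"
    and v_eq: "eventually (\<lambda>y. v (h y) = c * v y) cofinite" and "c \<noteq> 0"
    and T_eq: "eventually (\<lambda>y. T (h y) = a * T y + (d * (y + e) + k * v y)) cofinite"
    and "a \<noteq> 0" "d \<noteq> 0"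
  shows False
proof -
  have v_bounded: "Bfun v (at (fwd j))" "Bfun v (at (bwd j))" "Bfun v at_infinity" for j
    using bounded_on_orbit[OF \<open>finite S\<close> v, of c "\<lambda>_. 0"] v_eq \<open>c \<noteq> 0\<close> by auto
  have aff: "Bfun (\<lambda>y. d * (y + e)) (at z)" for z
    by (intro Bfun_tendsto[of _ "d * (z + e)"] tendsto_intros)
  have s_bounded: "Bfun (\<lambda>y. d * (y + e) + k * v y) (at (fwd j))"
    "Bfun (\<lambda>y. d * (y + e) + k * v y) (at (bwd j))" for j
    by (intro Bfun_add aff Bfun_cmult v_bounded)+
  note T_bounded = bounded_on_orbit[OF \<open>finite S\<close> T T_eq \<open>a \<noteq> 0\<close> s_bounded]
  have "Bfun (\<lambda>y. T (h y)) at_infinity"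
    using T_bounded(1)[of 0] filterlim_h_infinity unfolding fwd_0 by (rule Bfun_compose)
  then have "Bfun (\<lambda>y. (1 / d) * (T (h y) + ((- a) * T y + (- k) * v y)) + - e) at_infinity"
    by (intro Bfun_add Bfun_cmult T_bounded(3) v_bounded(3) Bfun_const)
  moreover have "eventually (\<lambda>y. T (h y) = a * T y + (d * (y + e) + k * v y)) at_infinity"
    using T_eq by (rule eventually_at_infinity_if_cofinite)
  then have "eventually (\<lambda>y. (1 / d) * (T (h y) + ((- a) * T y + (- k) * v y)) + - e = y) at_infinity"
    by eventually_elim (use \<open>d \<noteq> 0\<close> in simp)
  ultimately have "Bfun (\<lambda>y :: complex. y) at_infinity"
    by (rule Bfun_cong[rotated])
  then obtain A where "eventually (\<lambda>y :: complex. norm y \<le> A) at_infinity"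
    unfolding Bfun_def by blast
  then obtain B where "\<And>y :: complex. B \<le> norm y \<Longrightarrow> norm y \<le> A"
    unfolding eventually_at_infinity by blast
  from this[of "of_real (max B (\<bar>A\<bar> + 1))"] show False
    by (simp, arith)
qed

end

section \<open>The two leading coefficients in x\<close>

lemma coeff_mult_top:
  assumes "degree A \<le> m" "degree B \<le> n"
  shows "coeff (A * B) (m + n) = coeff A m * coeff B n"
proof (cases "degree A = m \<and> degree B = n")
  case True
  then show ?thesis using coeff_mult_degree_sum[of A B] by simp
next
  case False
  then have "degree (A * B) < m + n \<and> (coeff A m = 0 \<or> coeff B n = 0)"
    using assms degree_mult_le[of A B] by (auto simp: coeff_eq_0)
  then show ?thesis by (auto simp: coeff_eq_0)
qed

text \<open>
  \<open>coeff (pCons 0 A) m\<close> is the coefficient of index \<open>m - 1\<close>, read as \<open>0\<close> if \<open>m = 0\<close>. This avoids a separate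
  treatment of constant polynomials.
\<close>
lemma coeff_mult_second:
  fixes A B :: "complex poly"
  assumes "degree A \<le> m" "degree B \<le> n"
  shows "coeff (pCons 0 (A * B)) (m + n) =
    coeff (pCons 0 A) m * coeff B n + coeff A m * coeff (pCons 0 B) n"
proof -
  \<comment> \<open>Removing the leading term reduces the claim to leading coefficients.\<close>
  let ?A = "pCons 0 A - monom (coeff A m) (Suc m)"
  have "degree ?A \<le> m"
  proof (rule degree_le, intro allI impI)
    fix i assume "m < i"
    then show "coeff ?A i = 0"
      using assms(1) by (cases i) (auto simp: coeff_eq_0)
  qed
  have "pCons 0 (A * B) = ?A * B + monom (coeff A m) (Suc m) * B"
    by (simp add: algebra_simps)
  also have "monom (coeff A m) (Suc m) * B = monom (coeff A m) m * pCons 0 B"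
    by (simp add: monom_Suc)
  finally have "coeff (pCons 0 (A * B)) (m + n)
      = coeff (?A * B) (m + n) + coeff (monom (coeff A m) m * pCons 0 B) (m + n)"
    by (simp only: coeff_add)
  also have "coeff (monom (coeff A m) m * pCons 0 B) (m + n) = coeff A m * coeff (pCons 0 B) n"
    by (simp only: coeff_monom_mult) simp
  also have "coeff (?A * B) (m + n) = coeff (pCons 0 A) m * coeff B n"
    using coeff_mult_top[OF \<open>degree ?A \<le> m\<close> assms(2)] by simp
  finally show ?thesis .
qed

text \<open>
  The factor \<open>a\<close> on the left avoids the exponent \<open>m - 1\<close>.
\<close>
lemma coeff_pcompose_affine_top:
  fixes A :: "complex poly"
  assumes "degree A \<le> m"
  shows "coeff (pcompose A [:s, a:]) m = a ^ m * coeff A m"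
    and "a * coeff (pCons 0 (pcompose A [:s, a:])) m
      = a ^ m * (coeff (pCons 0 A) m + of_nat m * s * coeff A m)"
  using assms
proof (induction A arbitrary: m)
  case 0
  show "coeff (pcompose 0 [:s, a:]) m = a ^ m * coeff 0 m" for m
    by simp
  show "a * coeff (pCons 0 (pcompose 0 [:s, a:])) m
      = a ^ m * (coeff (pCons 0 0) m + of_nat m * s * coeff 0 m)" for m
    by simp
next
  case (pCons c A)
  have *: "coeff (pcompose (pCons c A) [:s, a:]) m = a ^ m * coeff (pCons c A) m \<and>
      a * coeff (pCons 0 (pcompose (pCons c A) [:s, a:])) m
      = a ^ m * (coeff (pCons 0 (pCons c A)) m + of_nat m * s * coeff (pCons c A) m)"
    if "degree (pCons c A) \<le> m" for m
  proof (cases m)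
    case 0
    with that have "A = 0" by (auto split: if_splits)
    with 0 show ?thesis by simp
  next
    case (Suc n)
    have deg: "degree A \<le> n"
      using that Suc by (auto split: if_splits)
    let ?A = "pcompose A [:s, a:]"
    have degc: "degree ?A \<le> n"
      using degree_pcompose_le[of A "[:s, a:]"] deg by (auto split: if_splits intro: order_trans)
    have IH: "coeff ?A n = a ^ n * coeff A n"
      "a * coeff (pCons 0 ?A) n = a ^ n * (coeff (pCons 0 A) n + of_nat n * s * coeff A n)"
      using pCons.IH[OF deg] by auto
    have comp: "pcompose (pCons c A) [:s, a:] = [:c:] + (smult s ?A + pCons 0 (smult a ?A))"
      by (simp add: pcompose_pCons)
    have "coeff (pcompose (pCons c A) [:s, a:]) m = a * coeff ?A n"
      unfolding comp using degc by (simp add: Suc coeff_eq_0)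
    then have top: "coeff (pcompose (pCons c A) [:s, a:]) m = a ^ m * coeff (pCons c A) m"
      using IH(1) by (simp add: Suc)
    have "a * coeff (pCons 0 (pcompose (pCons c A) [:s, a:])) m
        = a * coeff [:c:] n + s * a * coeff ?A n + a * (a * coeff (pCons 0 ?A) n)"
      unfolding comp by (cases n) (simp_all add: Suc algebra_simps)
    also have "\<dots> = a * coeff [:c:] n + s * a * (a ^ n * coeff A n)
        + a * (a ^ n * (coeff (pCons 0 A) n + of_nat n * s * coeff A n))"
      unfolding IH ..
    also have "\<dots> = a ^ m * (coeff (pCons 0 (pCons c A)) m + of_nat m * s * coeff (pCons c A) m)"
      by (cases n) (simp_all add: Suc algebra_simps)
    finally show ?thesis
      using top by blast
  qed
  fix m assume "degree (pCons c A) \<le> m"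
  from *[OF this] show "coeff (pcompose (pCons c A) [:s, a:]) m = a ^ m * coeff (pCons c A) m"
    "a * coeff (pCons 0 (pcompose (pCons c A) [:s, a:])) m
      = a ^ m * (coeff (pCons 0 (pCons c A)) m + of_nat m * s * coeff (pCons c A) m)"
    by blast+
qed

text \<open>
  Dividing the equation between the second coefficients by the one between the leading coefficients
  leaves the quotients of second by leading coefficients, and the factors \<open>A\<close>, \<open>B\<close> cancel. Primes denote second
  coefficients and a trailing \<open>h\<close> values at \<open>h(y)\<close>.
\<close>
lemma ratio_of_top_coefficients:
  fixes p q ph qh :: complex
  assumes nz: "p \<noteq> 0" "q \<noteq> 0" "ph \<noteq> 0" "qh \<noteq> 0" "A \<noteq> 0" "B \<noteq> 0" "\<mu> \<noteq> 0"
    and top: "A * ph * q = B * qh * (\<mu> * p)"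
    and second: "A * (p'h + m * s * ph) * q + a * (A * ph * q')
      = B * (q'h + n * s * qh) * (\<mu> * p) + a * (B * qh * (\<mu> * p' + \<epsilon> * e))"
  shows "p'h / ph - q'h / qh = a * (p' / p - q' / q) + (- (m - n) * s + a * \<epsilon> / \<mu> * (e / p))"
proof -
  have "p'h / ph + m * s + a * (q' / q) = (A * (p'h + m * s * ph) * q + a * (A * ph * q')) / (A * ph * q)"
    using nz by (simp add: add_divide_distrib)
  also have "\<dots> = (B * (q'h + n * s * qh) * (\<mu> * p) + a * (B * qh * (\<mu> * p' + \<epsilon> * e))) / (B * qh * (\<mu> * p))"
    by (simp only: top second)
  also have "\<dots> = q'h / qh + n * s + a * (p' / p + \<epsilon> * e / (\<mu> * p))"
    using nz by (simp add: add_divide_distrib ring_distribs)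
  finally have *: "p'h / ph + m * s + a * (q' / q) = q'h / qh + n * s + a * (p' / p + \<epsilon> * e / (\<mu> * p))" .
  have "p'h / ph - q'h / qh = (p'h / ph + m * s + a * (q' / q)) - m * s - a * (q' / q) - q'h / qh"
    by simp
  also have "\<dots> = a * (p' / p - q' / q) + (- (m - n) * s + a * \<epsilon> / \<mu> * (e / p))"
    unfolding * by (simp add: ring_distribs)
  finally show ?thesis .
qed

context moebius_orbit
begin

lemma eventually_h_cofinite:
  assumes "eventually P cofinite"
  shows "eventually (\<lambda>y. P (h y)) cofinite"
proof -
  have "{y. \<not> P (h y)} \<subseteq> {- g} \<union> h' ` {w. \<not> P w}"
  proof
    fix y assume "y \<in> {y. \<not> P (h y)}"
    then show "y \<in> {- g} \<union> h' ` {w. \<not> P w}"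
      using h'_h[of y] by (cases "y = - g") (auto simp: image_iff intro!: exI[of _ "h y"])
  qed
  then show ?thesis
    using assms unfolding eventually_cofinite by (auto intro: finite_subset)
qed

text \<open>
  \<open>W \<circ> f = \<mu> W + \<epsilon>\<close> for \<open>W = P / Q\<close>, as an identity between polynomials in \<open>x\<close> for almost every \<open>y\<close>. It makes
  sense also if \<open>P\<close> and \<open>Q\<close> have common factors, and admits multiplication by functions of \<open>y\<close>.
\<close>
definition semi_invariant ::
    "complex \<Rightarrow> complex \<Rightarrow> complex \<Rightarrow> complex \<Rightarrow> complex poly poly \<Rightarrow> complex poly poly \<Rightarrow> bool" where
  "semi_invariant a0 a \<mu> \<epsilon> P Q \<longleftrightarrow> eventually (\<lambda>y.
     pcompose (spec (h y) P) [:a0 + y, a:] * spec y Q =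
     pcompose (spec (h y) Q) [:a0 + y, a:] * (smult \<mu> (spec y P) + smult \<epsilon> (spec y Q))) cofinite"

lemma degree_pcompose_spec_le: "degree (pcompose (spec y P) [:s, a:]) \<le> degree P"
  using degree_pcompose_le[of "spec y P" "[:s, a:]"] degree_spec_le[of y P]
  by (auto split: if_splits intro: order_trans)

lemma eventually_poly_nonzero: "p \<noteq> 0 \<Longrightarrow> eventually (\<lambda>y. poly p y \<noteq> (0 :: complex)) cofinite"
  by (simp add: eventually_cofinite poly_roots_finite)

lemma Bfun_poly_quotient:
  fixes p q :: "complex poly"
  assumes "poly q z \<noteq> 0"
  shows "Bfun (\<lambda>y. poly p y / poly q y) (at z)"
proof (rule Bfun_tendsto)
  show "((\<lambda>y. poly p y / poly q y) \<longlongrightarrow> poly p z / poly q z) (at z)"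
    using assms poly_isCont[of z p] poly_isCont[of z q] by (intro tendsto_divide) (simp_all add: isCont_def)
qed

text \<open>
  The two leading coefficients at \<open>x = \<infinity>\<close> produce a solution of the equation excluded by
  \<open>no_rational_solution\<close>. There \<open>v\<close> is the reciprocal of the leading coefficient of \<open>P / Q\<close> if the degrees
  differ by one, the only case in which \<open>\<epsilon>\<close> reaches the second coefficient, and \<open>0\<close> otherwise.
\<close>
lemma no_semi_invariant_of_positive_degree:
  assumes semi: "semi_invariant a0 a \<mu> \<epsilon> P Q" and "a \<noteq> 0" "\<mu> \<noteq> 0" "Q \<noteq> 0"
    and deg: "degree Q < degree P"
  shows False
proof -
  define m n where "m = degree P" and "n = degree Q"
  define p q where "p = coeff P m" and "q = coeff Q n"
  define p' q' e where "p' = coeff (pCons 0 P) m" and "q' = coeff (pCons 0 Q) n"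
    and "e = coeff (pCons 0 Q) m"
  have "n < m" "degree P \<le> m" "degree Q \<le> n" "degree Q \<le> m"
    using deg by (auto simp: m_def n_def)
  have "p \<noteq> 0" "q \<noteq> 0"
    using deg \<open>Q \<noteq> 0\<close> by (auto simp: p_def q_def m_def n_def)
  define S where "S = {z. poly p z = 0} \<union> {z. poly q z = 0}"
  have "finite S"
    using \<open>p \<noteq> 0\<close> \<open>q \<noteq> 0\<close> by (simp add: S_def poly_roots_finite)
  define T where "T y = poly p' y / poly p y - poly q' y / poly q y" for y
  define v where "v y = poly e y / poly p y" for y
  have nonzero: "eventually (\<lambda>y. poly p y \<noteq> 0) cofinite" "eventually (\<lambda>y. poly q y \<noteq> 0) cofinite"
    using \<open>p \<noteq> 0\<close> \<open>q \<noteq> 0\<close> by (auto intro: eventually_poly_nonzero)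
  note nonzero_h = nonzero[THEN eventually_h_cofinite]
  let ?top = "\<lambda>y. a ^ m * poly p (h y) * poly q y = a ^ n * poly q (h y) * (\<mu> * poly p y)"
  let ?second = "\<lambda>y. a ^ m * (poly p' (h y) + of_nat m * (a0 + y) * poly p (h y)) * poly q y
        + a * (a ^ m * poly p (h y) * poly q' y)
      = a ^ n * (poly q' (h y) + of_nat n * (a0 + y) * poly q (h y)) * (\<mu> * poly p y)
        + a * (a ^ n * poly q (h y) * (\<mu> * poly p' y + \<epsilon> * poly e y))"
  have "eventually (\<lambda>y. ?top y \<and> ?second y) cofinite"
    using semi unfolding semi_invariant_def
  proof eventually_elim
    case (elim y)
    let ?P = "pcompose (spec (h y) P) [:a0 + y, a:]" and ?Q = "pcompose (spec (h y) Q) [:a0 + y, a:]"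
    let ?R = "smult \<mu> (spec y P) + smult \<epsilon> (spec y Q)"
    have coeffs: "coeff (spec z P) m = poly p z" "coeff (pCons 0 (spec z P)) m = poly p' z"
      "coeff (spec z Q) n = poly q z" "coeff (pCons 0 (spec z Q)) n = poly q' z"
      "coeff (pCons 0 (spec z Q)) m = poly e z" for z
      using coeff_spec[of z "pCons 0 P"] coeff_spec[of z "pCons 0 Q"]
      by (simp_all add: p_def p'_def q_def q'_def e_def)
    have degs: "degree (spec z P) \<le> m" "degree (spec z Q) \<le> n" "degree (spec z Q) \<le> m" for z
      using degree_spec_le[of z P] degree_spec_le[of z Q] \<open>n < m\<close> by (simp_all add: m_def n_def)
    have degPQ: "degree ?P \<le> m" "degree ?Q \<le> n"
      unfolding m_def n_def by (rule degree_pcompose_spec_le)+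
    have R: "degree ?R \<le> m" "coeff ?R m = \<mu> * poly p y" "coeff (pCons 0 ?R) m = \<mu> * poly p' y + \<epsilon> * poly e y"
    proof -
      show "degree ?R \<le> m"
        using degs by (intro degree_add_le order_trans[OF degree_smult_le]) auto
      have "coeff Q m = 0"
        using \<open>n < m\<close> by (simp add: coeff_eq_0 n_def)
      then show "coeff ?R m = \<mu> * poly p y"
        by (simp add: p_def)
      have "pCons 0 ?R = smult \<mu> (pCons 0 (spec y P)) + smult \<epsilon> (pCons 0 (spec y Q))"
        by simp
      then show "coeff (pCons 0 ?R) m = \<mu> * poly p' y + \<epsilon> * poly e y"
        by (simp only: coeff_add coeff_smult coeffs)
    qed
    have topP: "coeff ?P m = a ^ m * poly p (h y)" "coeff ?Q n = a ^ n * poly q (h y)"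
      unfolding coeffs(1,3)[symmetric] by (rule coeff_pcompose_affine_top degs)+
    have secondP: "a * coeff (pCons 0 ?P) m = a ^ m * (poly p' (h y) + of_nat m * (a0 + y) * poly p (h y))"
      "a * coeff (pCons 0 ?Q) n = a ^ n * (poly q' (h y) + of_nat n * (a0 + y) * poly q (h y))"
      unfolding coeffs[symmetric] by (rule coeff_pcompose_affine_top degs)+
    have "coeff (?P * spec y Q) (m + n) = coeff (?Q * ?R) (n + m)"
      using elim by (simp only: add.commute)
    then have "?top y"
      unfolding coeff_mult_top[OF degPQ(1) degs(2)] coeff_mult_top[OF degPQ(2) R(1)]
      by (simp only: topP coeffs R(2))
    have "a * coeff (pCons 0 (?P * spec y Q)) (m + n)
        = (a * coeff (pCons 0 ?P) m) * poly q y + a * (coeff ?P m * poly q' y)"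
      unfolding coeff_mult_second[OF degPQ(1) degs(2)] coeffs by (simp only: ring_distribs mult.assoc)
    moreover have "a * coeff (pCons 0 (?Q * ?R)) (n + m)
        = (a * coeff (pCons 0 ?Q) n) * (\<mu> * poly p y) + a * (coeff ?Q n * (\<mu> * poly p' y + \<epsilon> * poly e y))"
      unfolding coeff_mult_second[OF degPQ(2) R(1)] R(2,3) by (simp only: ring_distribs mult.assoc)
    ultimately have "?second y"
      unfolding secondP topP using elim by (simp only: add.commute[of n m])
    with \<open>?top y\<close> show ?case by blast
  qed
  then have top: "eventually ?top cofinite" and second: "eventually ?second cofinite"
    by (auto elim: eventually_mono)
  have e: "e = 0 \<or> e = q \<and> m = Suc n"
    using \<open>n < m\<close> coeff_eq_0[of Q "m - 1"]
    by (cases m) (auto simp: e_def q_def n_def less_Suc_eq)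
  have "eventually (\<lambda>y. v (h y) = a ^ (m - n) / \<mu> * v y) cofinite"
    using nonzero nonzero_h top
  proof eventually_elim
    case (elim y)
    from e show ?case
    proof
      assume "e = q \<and> m = Suc n"
      have "poly q (h y) / poly p (h y) = a * poly q y / (\<mu> * poly p y)"
        using elim \<open>a \<noteq> 0\<close> \<open>\<mu> \<noteq> 0\<close> \<open>e = q \<and> m = Suc n\<close> by (simp add: frac_eq_eq mult_ac)
      then show ?thesis
        using \<open>e = q \<and> m = Suc n\<close> by (simp add: v_def)
    qed (simp add: v_def)
  qed
  moreover have "eventually (\<lambda>y. T (h y) = a * T y + (- (of_nat m - of_nat n) * (y + a0)
      + a * \<epsilon> / \<mu> * v y)) cofinite"
    using nonzero nonzero_h top second
  proof eventually_elim
    case (elim y)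
    show ?case
      using ratio_of_top_coefficients[OF elim(1-4) _ _ \<open>\<mu> \<noteq> 0\<close> elim(5,6)] \<open>a \<noteq> 0\<close>
      by (simp add: T_def v_def add.commute)
  qed
  moreover have "Bfun v (at z)" if "z \<notin> S" for z
    using that Bfun_poly_quotient[of p z e] by (simp add: v_def[abs_def] S_def)
  moreover have "Bfun T (at z)" if "z \<notin> S" for z
    using that Bfun_add[OF Bfun_poly_quotient[of p z p'] Bfun_cmult[OF Bfun_poly_quotient[of q z q'], of "- 1"]]
    by (simp add: T_def[abs_def] S_def)
  ultimately show False
    using no_rational_solution[OF \<open>finite S\<close>, of T v "a ^ (m - n) / \<mu>" a
      "- (of_nat m - of_nat n)" a0 "a * \<epsilon> / \<mu>"] \<open>a \<noteq> 0\<close> \<open>\<mu> \<noteq> 0\<close> \<open>n < m\<close> by simp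
qed

lemma top_coefficient_relation:
  assumes "semi_invariant a0 a \<mu> \<epsilon> P Q" "degree P \<le> d" "degree Q \<le> d"
  shows "eventually (\<lambda>y. a ^ d * poly (coeff P d) (h y) * poly (coeff Q d) y =
    a ^ d * poly (coeff Q d) (h y) * (\<mu> * poly (coeff P d) y + \<epsilon> * poly (coeff Q d) y)) cofinite"
  using assms(1) unfolding semi_invariant_def
proof eventually_elim
  case (elim y)
  let ?P = "pcompose (spec (h y) P) [:a0 + y, a:]" and ?Q = "pcompose (spec (h y) Q) [:a0 + y, a:]"
  let ?R = "smult \<mu> (spec y P) + smult \<epsilon> (spec y Q)"
  have degs: "degree (spec z P) \<le> d" "degree (spec z Q) \<le> d" for z
    using degree_spec_le[of z P] degree_spec_le[of z Q] assms(2,3) by simp_all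
  have degPQ: "degree ?P \<le> d" "degree ?Q \<le> d"
    using degree_pcompose_spec_le assms(2,3) by (blast intro: order_trans)+
  have "degree ?R \<le> d"
    using degs by (intro degree_add_le order_trans[OF degree_smult_le]) auto
  then have "coeff ?P d * coeff (spec y Q) d = coeff ?Q d * coeff ?R d"
    using elim coeff_mult_top[OF degPQ(1) degs(2)[of y]] coeff_mult_top[OF degPQ(2)] by simp
  then show ?case
    using coeff_pcompose_affine_top(1)[OF degs(1), of "h y" "a0 + y" a]
      coeff_pcompose_affine_top(1)[OF degs(2), of "h y" "a0 + y" a] by simp
qed

lemma semi_invariant_swap:
  assumes "semi_invariant a0 a \<mu> 0 P Q" "\<mu> \<noteq> 0"
  shows "semi_invariant a0 a (1 / \<mu>) 0 Q P"
  using assms(1) unfolding semi_invariant_def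
proof eventually_elim
  case (elim y)
  then have "smult (1 / \<mu>) (pcompose (spec (h y) P) [:a0 + y, a:] * spec y Q)
    = smult (1 / \<mu>) (pcompose (spec (h y) Q) [:a0 + y, a:] * smult \<mu> (spec y P))"
    by simp
  then show ?case
    using assms(2) by simp
qed

text \<open>
  If \<open>p / q\<close>, a function of \<open>y\<close>, satisfies the same affine equation as \<open>P / Q\<close>, then the difference satisfies the
  linear one.
\<close>
lemma semi_invariant_subtract_leading:
  assumes semi: "semi_invariant a0 a \<mu> \<epsilon> P Q"
    and lead: "eventually (\<lambda>y. poly p (h y) * poly q y =
      poly q (h y) * (\<mu> * poly p y + \<epsilon> * poly q y)) cofinite"
  shows "semi_invariant a0 a \<mu> 0 (smult q P - smult p Q) (smult q Q)"
  using semi lead unfolding semi_invariant_def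
proof eventually_elim
  case (elim y)
  let ?P = "pcompose (spec (h y) P) [:a0 + y, a:]" and ?Q = "pcompose (spec (h y) Q) [:a0 + y, a:]"
  \<comment> \<open>Scalar factors are written as constant polynomials, so that ring normalisation applies.\<close>
  define A B C D where "A = [:poly p (h y):]" and "B = [:poly q (h y):]"
    and "C = [:poly p y:]" and "D = [:poly q y:]"
  define M N where "M = [:\<mu>:]" and "N = [:\<epsilon>:]"
  have 1: "?P * spec y Q = ?Q * (M * spec y P + N * spec y Q)"
    using elim(1) by (simp add: M_def N_def)
  have "A * D = [:poly p (h y) * poly q y:]"
    by (simp add: A_def D_def)
  also note elim(2)
  also have "[:poly q (h y) * (\<mu> * poly p y + \<epsilon> * poly q y):] = B * (M * C + N * D)"
    by (simp add: B_def C_def D_def M_def N_def algebra_simps)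
  finally have 2: "A * D = B * (M * C + N * D)" .
  have "(B * ?P - A * ?Q) * (D * spec y Q) = D * B * (?P * spec y Q) - A * D * (?Q * spec y Q)"
    by (simp add: algebra_simps)
  also have "\<dots> = (B * ?Q) * (M * (D * spec y P - C * spec y Q))"
    unfolding 1 2 by (simp add: algebra_simps)
  finally have "(B * ?P - A * ?Q) * (D * spec y Q) = (B * ?Q) * (M * (D * spec y P - C * spec y Q))" .
  then show ?case
    by (simp add: A_def B_def C_def D_def M_def pcompose_diff pcompose_smult)
qed

text \<open>
  The remaining cases reduce to a numerator of larger degree. If the denominator has the larger degree, comparing
  coefficients gives \<open>\<epsilon> = 0\<close> and \<open>W\<close> may be replaced by its reciprocal; if the degrees agree, the value \<open>p / q\<close> of \<open>W\<close> at
  \<open>x = \<infinity>\<close> satisfies the same equation, and one passes to \<open>1 / (W - p / q)\<close>.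
\<close>
lemma yfield_if_semi_invariant:
  assumes semi: "semi_invariant a0 a \<mu> \<epsilon> P Q" and "a \<noteq> 0" "\<mu> \<noteq> 0" "Q \<noteq> 0"
  shows "to_fract P / to_fract Q \<in> yfield"
proof (rule ccontr)
  assume notin: "to_fract P / to_fract Q \<notin> yfield"
  then have "P \<noteq> 0"
    by (auto intro: yfield_0)
  consider (gt) "degree Q < degree P" | (lt) "degree P < degree Q" | (eq) "degree P = degree Q"
    by linarith
  then show False
  proof cases
    case gt
    then show False
      using no_semi_invariant_of_positive_degree assms by blast
  next
    case lt
    let ?q = "coeff Q (degree Q)"
    have "?q \<noteq> 0"
      using \<open>Q \<noteq> 0\<close> by simp
    have nz: "eventually (\<lambda>y. poly ?q y \<noteq> 0) cofinite"
      using eventually_poly_nonzero[OF \<open>?q \<noteq> 0\<close>] .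
    have "coeff P (degree Q) = 0"
      using lt by (simp add: coeff_eq_0)
    have "eventually (\<lambda>y. \<epsilon> = 0) (cofinite :: complex filter)"
      using top_coefficient_relation[OF semi less_imp_le[OF lt] order_refl] nz eventually_h_cofinite[OF nz]
    proof eventually_elim
      case (elim y)
      then show ?case
        using \<open>coeff P (degree Q) = 0\<close> \<open>a \<noteq> 0\<close> by simp
    qed
    then have "\<epsilon> = 0"
      by (simp add: eventually_const_iff infinite_UNIV_char_0)
    then have "semi_invariant a0 a (1 / \<mu>) 0 Q P"
      using semi semi_invariant_swap \<open>\<mu> \<noteq> 0\<close> by blast
    then show False
      by (rule no_semi_invariant_of_positive_degree[OF _ \<open>a \<noteq> 0\<close> _ \<open>P \<noteq> 0\<close> lt])
        (use \<open>\<mu> \<noteq> 0\<close> in simp)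
  next
    case eq
    define p q where "p = coeff P (degree Q)" and "q = coeff Q (degree Q)"
    have "q \<noteq> 0"
      using \<open>Q \<noteq> 0\<close> by (simp add: q_def)
    have lead: "eventually (\<lambda>y. poly p (h y) * poly q y =
      poly q (h y) * (\<mu> * poly p y + \<epsilon> * poly q y)) cofinite"
      using top_coefficient_relation[OF semi, of "degree Q"] eq \<open>a \<noteq> 0\<close>
      by (simp add: p_def q_def mult.assoc)
    let ?P = "smult q P - smult p Q"
    have "semi_invariant a0 a \<mu> 0 ?P (smult q Q)"
      using semi lead by (rule semi_invariant_subtract_leading)
    then have semi': "semi_invariant a0 a (1 / \<mu>) 0 (smult q Q) ?P"
      using \<open>\<mu> \<noteq> 0\<close> by (rule semi_invariant_swap)
    have "?P \<noteq> 0"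
    proof
      assume "?P = 0"
      then have "P * [:q:] = [:p:] * Q"
        by simp
      then have "to_fract P / to_fract Q = to_fract [:p:] / to_fract [:q:]"
        using fract_eq_iff[of Q "[:q:]" P "[:p:]"] \<open>Q \<noteq> 0\<close> \<open>q \<noteq> 0\<close> by simp
      then show False
        using notin yfieldI[OF \<open>q \<noteq> 0\<close>] by simp
    qed
    have "degree ?P \<le> degree Q"
      using eq by (intro degree_diff_le order_trans[OF degree_smult_le]) auto
    moreover have "coeff ?P (degree Q) = 0"
      by (simp add: p_def q_def mult.commute)
    ultimately have "degree ?P < degree Q"
      using \<open>?P \<noteq> 0\<close> by (metis le_neq_implies_less leading_coeff_0_iff)
    then have "degree ?P < degree (smult q Q)"
      using \<open>q \<noteq> 0\<close> by simp
    then show False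
      using no_semi_invariant_of_positive_degree[OF semi' \<open>a \<noteq> 0\<close> _ \<open>?P \<noteq> 0\<close>] \<open>\<mu> \<noteq> 0\<close> by simp
  qed
qed

end

section \<open>Uniqueness of the invariant fibration\<close>

text \<open>
  If \<open>\<infinity>\<close> is not fixed by the Moebius map, there is a finite fixed point \<open>z\<close>, and \<open>1 / (W - z)\<close> is transformed affinely.
\<close>
lemma moebius_to_affine:
  assumes "a * d - b * c \<noteq> 0" "nonconstant W" "dominant f" "W \<circ>\<^sub>r f = moebius a b c d W"
  obtains V \<mu> \<epsilon> where "V \<circ>\<^sub>r f = cst \<mu> * V + cst \<epsilon>" "\<mu> \<noteq> 0" "V \<in> yfield \<Longrightarrow> W \<in> yfield"
proof (cases "c = 0")
  case True
  show ?thesis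
  proof (rule that[of W "a / d" "b / d"])
    show "W \<circ>\<^sub>r f = cst (a / d) * W + cst (b / d)"
      unfolding assms(4) moebius_def using True by (simp add: add_divide_distrib)
  qed (use True assms(1) in auto)
next
  case False
  \<comment> \<open>The roots of \<open>c z\<^sup>2 + (d - a) z - b\<close> are the finite fixed points.\<close>
  let ?p = "[:- b, d - a, c:]"
  have "\<not> constant (poly ?p)"
    using False constant_degree[of ?p] by simp
  then obtain z where "poly ?p z = 0"
    using fundamental_theorem_of_algebra by blast
  then have z: "b = c * z * z + (d - a) * z"
    by (simp add: algebra_simps)
  have det: "a * d - b * c = (a - c * z) * (c * z + d)"
    unfolding z by (simp add: algebra_simps)
  then have nz: "a - c * z \<noteq> 0" "c * z + d \<noteq> 0"
    using assms(1) by auto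
  have W: "W - cst z \<noteq> 0"
    using assms(2) by (auto simp: nonconstant_def)
  have cWd: "cst c * W + cst d \<noteq> 0"
  proof
    assume "cst c * W + cst d = 0"
    then have "cst c * W = cst (- d)"
      by (simp add: add_eq_0_iff)
    then have "W = cst (- d / c)"
      using False by (metis cst_divide cst_eq_0_iff nonzero_mult_div_cancel_left)
    then show False
      using assms(2) unfolding nonconstant_def by blast
  qed
  define V where "V = 1 / (W - cst z)"
  show ?thesis
  proof (rule that[of V "(c * z + d) / (a - c * z)" "c / (a - c * z)"])
    have "W \<circ>\<^sub>r f - cst z = ((cst a * W + cst b) - cst z * (cst c * W + cst d)) / (cst c * W + cst d)"
      unfolding assms(4) moebius_def using cWd by (simp add: diff_divide_distrib)
    also have "(cst a * W + cst b) - cst z * (cst c * W + cst d) = cst (a - c * z) * (W - cst z)"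
      unfolding z by (simp add: algebra_simps)
    finally have "V \<circ>\<^sub>r f = (cst c * W + cst d) / (cst (a - c * z) * (W - cst z))"
      unfolding V_def using assms(3) by simp
    also have "cst c * W + cst d = cst (c * z + d) + cst c * (W - cst z)"
      by (simp add: algebra_simps)
    also have "(cst (c * z + d) + cst c * (W - cst z)) / (cst (a - c * z) * (W - cst z))
        = cst ((c * z + d) / (a - c * z)) * V + cst (c / (a - c * z))"
      unfolding V_def cst_divide using W by (simp add: add_divide_distrib del: cst_simps)
    finally show "V \<circ>\<^sub>r f = cst ((c * z + d) / (a - c * z)) * V + cst (c / (a - c * z))" .
    show "(c * z + d) / (a - c * z) \<noteq> 0"
      using nz by simp
    assume "V \<in> yfield"
    then have "inverse V + cst z \<in> yfield"
      by blast
    then show "W \<in> yfield"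
      by (simp add: V_def)
  qed
qed

text \<open>
  A Moebius map has a fixed point, so it may be taken affine; the equation is then read off at points.
\<close>
lemma invariant_fibration_in_yfield:
  assumes "\<alpha> \<noteq> 0" "\<beta> \<noteq> 0" "\<not> periodic \<beta> \<gamma>"
    and inv: "invariant_fibration (f_map \<alpha>\<^sub>0 \<alpha> \<beta> \<gamma>) W"
  shows "W \<in> yfield"
proof -
  interpret moebius_orbit \<beta> \<gamma>
    by unfold_locales (use assms lucas_nonzero_if_not_periodic in auto)
  let ?f = "f_map \<alpha>\<^sub>0 \<alpha> \<beta> \<gamma>"
  have dom: "dominant ?f"
    using assms by simp
  from inv obtain a b c d where "nonconstant W" "a * d - b * c \<noteq> 0" "W \<circ>\<^sub>r ?f = moebius a b c d W"
    by (auto simp: invariant_fibration_def)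
  then obtain V \<mu> \<epsilon> where V: "V \<circ>\<^sub>r ?f = cst \<mu> * V + cst \<epsilon>" "\<mu> \<noteq> 0" "V \<in> yfield \<Longrightarrow> W \<in> yfield"
    using moebius_to_affine[OF _ _ dom] by metis
  obtain P Q where PQ: "V = to_fract P / to_fract Q" "Q \<noteq> 0"
    by (rule ratfun_cases)
  let ?R = "smult [:\<mu>:] P + smult [:\<epsilon>:] Q"
  have R: "to_fract ?R = cst \<mu> * to_fract P + cst \<epsilon> * to_fract Q"
    by (simp add: cst_def flip: to_fract_mult to_fract_add)
  note V(1)
  also have "cst \<mu> * V + cst \<epsilon> = to_fract ?R / to_fract Q"
    unfolding R using PQ(2) by (simp add: PQ(1) add_divide_distrib)
  finally have "V \<circ>\<^sub>r ?f = to_fract ?R / to_fract Q" .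
  moreover have "V \<circ>\<^sub>r ?f = poly_subst P ?f / poly_subst Q ?f"
    unfolding PQ(1) using dom PQ(2) by (rule rcomp_fract)
  moreover have "poly_subst Q ?f \<noteq> 0" "to_fract Q \<noteq> 0"
    using dom PQ(2) by (auto simp: dominant_def)
  ultimately have eq: "poly_subst P ?f * to_fract Q = poly_subst Q ?f * to_fract ?R"
    by (metis frac_eq_eq mult.commute)
  have "semi_invariant \<alpha>\<^sub>0 \<alpha> \<mu> \<epsilon> P Q"
    unfolding semi_invariant_def eventually_cofinite
  proof (rule finite_subset)
    show "finite {- \<gamma>}" by simp
    have "pcompose (spec (h y) P) [:\<alpha>\<^sub>0 + y, \<alpha>:] * spec y Q =
       pcompose (spec (h y) Q) [:\<alpha>\<^sub>0 + y, \<alpha>:] * (smult \<mu> (spec y P) + smult \<epsilon> (spec y Q))"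
      if "y \<noteq> - \<gamma>" for y
    proof (subst poly_eq_poly_eq_iff[symmetric], rule ext)
      fix x
      show "poly (pcompose (spec (h y) P) [:\<alpha>\<^sub>0 + y, \<alpha>:] * spec y Q) x =
        poly (pcompose (spec (h y) Q) [:\<alpha>\<^sub>0 + y, \<alpha>:] * (smult \<mu> (spec y P) + smult \<epsilon> (spec y Q))) x"
        using f_map_identity_at_points[OF assms(1,2) eq that, of x]
        by (simp add: ev_def h_def poly_pcompose add_ac mult_ac)
    qed
    then show "{y. pcompose (spec (h y) P) [:\<alpha>\<^sub>0 + y, \<alpha>:] * spec y Q \<noteq>
       pcompose (spec (h y) Q) [:\<alpha>\<^sub>0 + y, \<alpha>:] * (smult \<mu> (spec y P) + smult \<epsilon> (spec y Q))} \<subseteq> {- \<gamma>}"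
      by blast
  qed
  then have "V \<in> yfield"
    unfolding PQ(1) using assms(1) V(2) PQ(2) by (rule yfield_if_semi_invariant)
  then show ?thesis
    by (rule V(3))
qed

section \<open>Invariant fibrations and first integrals of the map\<close>

lemma unique_invariant_fibration_Y:
  assumes "\<alpha> \<noteq> 0" "\<beta> \<noteq> 0" "\<not> periodic \<beta> \<gamma>"
  shows "unique_invariant_fibration (f_map \<alpha>\<^sub>0 \<alpha> \<beta> \<gamma>) Y"
proof -
  have "Y \<notin> range cst"
    using Y_notin_finite_at_infinity finite_at_infinity_cst by (metis imageE)
  then have Y: "nonconstant Y"
    by (simp add: nonconstant_def)
  \<comment> \<open>On \<open>y\<close> the map acts by \<open>h\<close> itself.\<close>
  have "Y \<circ>\<^sub>r f_map \<alpha>\<^sub>0 \<alpha> \<beta> \<gamma> = moebius 0 \<beta> 1 \<gamma> Y"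
    using assms by (simp add: moebius_def h_map_def add.commute)
  then have "invariant_fibration (f_map \<alpha>\<^sub>0 \<alpha> \<beta> \<gamma>) Y"
    unfolding invariant_fibration_def using Y assms(2)
    by (intro conjI exI[of _ 0] exI[of _ \<beta>] exI[of _ 1] exI[of _ \<gamma>]) simp_all
  moreover have "same_fibration W Y" if W: "invariant_fibration (f_map \<alpha>\<^sub>0 \<alpha> \<beta> \<gamma>) W" for W
  proof (rule same_fibration_yfield)
    show "W \<in> yfield"
      using assms W by (rule invariant_fibration_in_yfield)
    show "nonconstant W"
      using W by (simp add: invariant_fibration_def)
  qed (use Y in auto)
  ultimately show ?thesis
    by (simp add: unique_invariant_fibration_def)
qed

lemma H1_yfield: "H1 \<beta> \<gamma> k \<in> yfield"
  by (auto simp: H1_eq)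

lemma not_same_fibration_H1:
  assumes "\<beta> \<noteq> 0" "k_periodic \<beta> \<gamma> k" "V \<notin> yfield"
  shows "\<not> same_fibration V (H1 \<beta> \<gamma> k)"
  using assms nonconstant_geometric_orbit_sum[of 1 \<beta>]
  by (intro not_same_fibration_yfield H1_yfield) (auto simp: H1_eq)

text \<open>
  Affine maps are the Moebius maps that occur, and a function that involves \<open>x\<close> never has the fibres of \<open>H\<^sub>1\<close>.
\<close>
lemma second_invariant_fibrationI:
  assumes "\<beta> \<noteq> 0" "k_periodic \<beta> \<gamma> k" "V \<notin> yfield"
    and "V \<circ>\<^sub>r f = cst \<mu> * V + cst \<epsilon>" "\<mu> \<noteq> 0"
  shows "second_invariant_fibration f (H1 \<beta> \<gamma> k) V"
proof -
  have "V \<circ>\<^sub>r f = moebius \<mu> \<epsilon> 0 1 V"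
    by (simp add: moebius_def assms(4))
  then have "invariant_fibration f V"
    unfolding invariant_fibration_def using nonconstant_if_notin_yfield[OF assms(3)] assms(5)
    by (intro conjI exI[of _ \<mu>] exI[of _ \<epsilon>] exI[of _ 0] exI[of _ 1]) simp_all
  then show ?thesis
    using not_same_fibration_H1[OF assms(1-3)] by (simp add: second_invariant_fibration_def)
qed

lemma conj_by_translation_f_map:
  assumes "\<alpha> \<noteq> 0" "\<beta> \<noteq> 0" "\<alpha>\<^sub>0 = a * (1 - \<alpha>)"
  shows "conj_by_translation a 0 (f_map \<alpha>\<^sub>0 \<alpha> \<beta> \<gamma>) (f_map 0 \<alpha> \<beta> \<gamma>)"
proof -
  have "cst \<alpha>\<^sub>0 = cst a * (1 - cst \<alpha>)"
    by (simp add: assms(3))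
  moreover have "h_map \<beta> \<gamma> (snd (translation a 0)) = h_map \<beta> \<gamma> Y"
    by (simp add: translation_def)
  ultimately have "ratmap_comp (f_map \<alpha>\<^sub>0 \<alpha> \<beta> \<gamma>) (translation a 0)
      = (cst \<alpha> * X + Y + cst a, h_map \<beta> \<gamma> Y)"
    by (simp add: ratmap_comp_def) (simp add: translation_def algebra_simps)
  moreover have "ratmap_comp (translation a 0) (f_map 0 \<alpha> \<beta> \<gamma>)
      = (cst \<alpha> * X + Y + cst a, h_map \<beta> \<gamma> Y)"
    using assms by (simp add: ratmap_comp_def translation_def)
  ultimately show ?thesis
    by (simp add: conj_by_translation_def)
qed

lemma V2_b1_eq: "V2_b1 \<alpha> \<beta> \<gamma> k = cst (\<alpha> ^ k - 1) * X + geometric_orbit_sum \<alpha> \<beta> \<gamma> k"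
  by (simp add: V2_b1_def geometric_orbit_sum_def)

lemma V2_b1_translated:
  "V2_b1 \<alpha> \<beta> \<gamma> k \<circ>\<^sub>r translation (- a) 0 =
    cst (\<alpha> ^ k - 1) * (X - cst a) + geometric_orbit_sum \<alpha> \<beta> \<gamma> k"
  unfolding V2_b1_eq
  by (simp add: geometric_orbit_sum_rcomp_translation del: cst_simps cst_power)
    (simp add: translation_def)

lemma V2_b2_eq: "V2_b2 \<alpha> \<beta> \<gamma> k =
    (of_nat k * X + weighted_orbit_sum \<alpha> \<beta> \<gamma> k) / geometric_orbit_sum \<alpha> \<beta> \<gamma> k"
  by (simp add: V2_b2_def geometric_orbit_sum_def weighted_orbit_sum_def)

lemma V2_b2_translated:
  "V2_b2 \<alpha> \<beta> \<gamma> k \<circ>\<^sub>r translation (- a) 0 =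
    (of_nat k * (X - cst a) + weighted_orbit_sum \<alpha> \<beta> \<gamma> k) / geometric_orbit_sum \<alpha> \<beta> \<gamma> k"
  unfolding V2_b2_eq
  by (simp add: geometric_orbit_sum_rcomp_translation weighted_orbit_sum_rcomp_translation)
    (simp add: translation_def)

lemma V2_b3_eq: "V2_b3 \<alpha>\<^sub>0 \<beta> \<gamma> k = (of_nat k * (X - cst 0) + weighted_orbit_sum 1 \<beta> \<gamma> k) /
    (cst (of_nat k * \<alpha>\<^sub>0) + geometric_orbit_sum 1 \<beta> \<gamma> k)"
  by (simp add: V2_b3_def geometric_orbit_sum_def weighted_orbit_sum_def)

text \<open>
  For \<open>a = 0\<close> this is the function in normalised coordinates, in general its translate. A power of an
  eigenfunction whose eigenvalue is a root of unity is a first integral.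
\<close>
lemma eigenfunction_fibration:
  assumes "\<alpha> \<noteq> 0" "\<beta> \<noteq> 0" "k_periodic \<beta> \<gamma> k" "\<alpha> ^ k \<noteq> 1" "\<alpha>\<^sub>0 = a * (1 - \<alpha>)"
  defines "V \<equiv> cst (\<alpha> ^ k - 1) * (X - cst a) + geometric_orbit_sum \<alpha> \<beta> \<gamma> k"
  shows "V \<circ>\<^sub>r f_map \<alpha>\<^sub>0 \<alpha> \<beta> \<gamma> = cst \<alpha> * V"
    and "second_invariant_fibration (f_map \<alpha>\<^sub>0 \<alpha> \<beta> \<gamma>) (H1 \<beta> \<gamma> k) V"
    and "n > 0 \<Longrightarrow> \<alpha> ^ n = 1 \<Longrightarrow> second_first_integral (f_map \<alpha>\<^sub>0 \<alpha> \<beta> \<gamma>) (H1 \<beta> \<gamma> k) (V ^ n)"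
proof -
  let ?f = "f_map \<alpha>\<^sub>0 \<alpha> \<beta> \<gamma>"
  have dom: "dominant ?f"
    using assms by simp
  show eq: "V \<circ>\<^sub>r ?f = cst \<alpha> * V"
    unfolding V_def using dom assms(3,5) by (rule eigenfunction_rcomp)
  let ?R = "geometric_orbit_sum \<alpha> \<beta> \<gamma> k - cst ((\<alpha> ^ k - 1) * a)"
  have V: "V = cst (\<alpha> ^ k - 1) * X + ?R"
    by (simp add: V_def algebra_simps)
  have notin: "V ^ n \<notin> yfield" if "n > 0" for n
    unfolding V using that assms(4)
    by (intro power_linear_in_X_notin_yfield yfield_diff geometric_orbit_sum_yfield yfield_cst) auto
  show "second_invariant_fibration ?f (H1 \<beta> \<gamma> k) V"
    using second_invariant_fibrationI[OF assms(2,3) _ _ assms(1), of V ?f 0] notin[of 1] eq by simp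
  assume n: "n > 0" "\<alpha> ^ n = 1"
  have "V ^ n \<circ>\<^sub>r ?f = cst (\<alpha> ^ n) * V ^ n"
    using dom eq by (simp add: power_mult_distrib)
  then show "second_first_integral ?f (H1 \<beta> \<gamma> k) (V ^ n)"
    using n notin[OF n(1)] not_same_fibration_H1[OF assms(2,3)] nonconstant_if_notin_yfield
    by (simp add: second_first_integral_def first_integral_def)
qed

text \<open>
  The numerator has degree one in \<open>x\<close> since \<open>k > 0\<close>.
\<close>
lemma translating_function_fibration:
  assumes "\<alpha> \<noteq> 0" "\<beta> \<noteq> 0" "k_periodic \<beta> \<gamma> k" "\<alpha> ^ k = 1"
    and "\<alpha> * e = e" "of_nat k * (\<alpha>\<^sub>0 - a + \<alpha> * a) = \<alpha> * e"
  defines "V \<equiv> (of_nat k * (X - cst a) + weighted_orbit_sum \<alpha> \<beta> \<gamma> k) /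
    (cst e + geometric_orbit_sum \<alpha> \<beta> \<gamma> k)"
  shows "V \<circ>\<^sub>r f_map \<alpha>\<^sub>0 \<alpha> \<beta> \<gamma> = V + 1"
    and "second_invariant_fibration (f_map \<alpha>\<^sub>0 \<alpha> \<beta> \<gamma>) (H1 \<beta> \<gamma> k) V"
proof -
  let ?f = "f_map \<alpha>\<^sub>0 \<alpha> \<beta> \<gamma>"
  have dom: "dominant ?f"
    using assms by simp
  note * = translating_function_rcomp[OF dom assms(1-6)]
  show eq: "V \<circ>\<^sub>r ?f = V + 1"
    unfolding V_def by (rule *(2))
  have "k > 0"
    using assms(3) by (simp add: k_periodic_def)
  have "V = (cst (of_nat k) * X + (weighted_orbit_sum \<alpha> \<beta> \<gamma> k - cst (of_nat k * a))) /
    (cst e + geometric_orbit_sum \<alpha> \<beta> \<gamma> k)"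
    by (simp add: V_def algebra_simps)
  also have "\<dots> \<notin> yfield"
    using \<open>k > 0\<close> *(1) 
    by (intro linear_in_X_notin_yfield yfield_add yfield_diff weighted_orbit_sum_yfield
        geometric_orbit_sum_yfield yfield_cst) auto
  finally show "second_invariant_fibration ?f (H1 \<beta> \<gamma> k) V"
    using second_invariant_fibrationI[OF assms(2,3), of V ?f 1 1] eq by simp
qed

text \<open>
  The translation moves \<open>\<alpha>\<^sub>0 / (1 - \<alpha>)\<close>, the fixed point of \<open>x \<mapsto> \<alpha>\<^sub>0 + \<alpha> x\<close>, to the origin; the coordinate \<open>y\<close> is
  left alone. The same choice serves the two lemmas that follow.
\<close>
lemma eigenfunction_fibration_after_translation:
  assumes "\<alpha> \<noteq> 0" "\<beta> \<noteq> 0" "k_periodic \<beta> \<gamma> k" "\<alpha> ^ k \<noteq> 1"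
  shows "\<exists>a b. conj_by_translation a b (f_map \<alpha>\<^sub>0 \<alpha> \<beta> \<gamma>) (f_map 0 \<alpha> \<beta> \<gamma>)
    \<and> second_invariant_fibration (f_map \<alpha>\<^sub>0 \<alpha> \<beta> \<gamma>) (H1 \<beta> \<gamma> k)
        (V2_b1 \<alpha> \<beta> \<gamma> k \<circ>\<^sub>r translation (- a) (- b))"
proof (intro exI conjI)
  have "\<alpha> \<noteq> 1"
    using assms(4) by auto
  then have *: "\<alpha>\<^sub>0 = \<alpha>\<^sub>0 / (1 - \<alpha>) * (1 - \<alpha>)"
    by simp
  show "conj_by_translation (\<alpha>\<^sub>0 / (1 - \<alpha>)) 0 (f_map \<alpha>\<^sub>0 \<alpha> \<beta> \<gamma>) (f_map 0 \<alpha> \<beta> \<gamma>)"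
    using assms(1,2) * by (rule conj_by_translation_f_map)
  show "second_invariant_fibration (f_map \<alpha>\<^sub>0 \<alpha> \<beta> \<gamma>) (H1 \<beta> \<gamma> k)
      (V2_b1 \<alpha> \<beta> \<gamma> k \<circ>\<^sub>r translation (- (\<alpha>\<^sub>0 / (1 - \<alpha>))) (- 0))"
    unfolding minus_zero V2_b1_translated using assms * by (rule eigenfunction_fibration)
qed

lemma second_first_integral_after_translation:
  assumes "\<alpha> \<noteq> 0" "\<beta> \<noteq> 0" "k_periodic \<beta> \<gamma> k" "\<alpha> ^ k \<noteq> 1" "n > 0" "\<alpha> ^ n = 1"
  shows "\<exists>a b. conj_by_translation a b (f_map \<alpha>\<^sub>0 \<alpha> \<beta> \<gamma>) (f_map 0 \<alpha> \<beta> \<gamma>)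
    \<and> second_first_integral (f_map \<alpha>\<^sub>0 \<alpha> \<beta> \<gamma>) (H1 \<beta> \<gamma> k)
        (V2_b1 \<alpha> \<beta> \<gamma> k ^ n \<circ>\<^sub>r translation (- a) (- b))"
proof (intro exI conjI)
  have "\<alpha> \<noteq> 1"
    using assms(4) by auto
  then have *: "\<alpha>\<^sub>0 = \<alpha>\<^sub>0 / (1 - \<alpha>) * (1 - \<alpha>)"
    by simp
  show "conj_by_translation (\<alpha>\<^sub>0 / (1 - \<alpha>)) 0 (f_map \<alpha>\<^sub>0 \<alpha> \<beta> \<gamma>) (f_map 0 \<alpha> \<beta> \<gamma>)"
    using assms(1,2) * by (rule conj_by_translation_f_map)
  show "second_first_integral (f_map \<alpha>\<^sub>0 \<alpha> \<beta> \<gamma>) (H1 \<beta> \<gamma> k)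
      (V2_b1 \<alpha> \<beta> \<gamma> k ^ n \<circ>\<^sub>r translation (- (\<alpha>\<^sub>0 / (1 - \<alpha>))) (- 0))"
    unfolding minus_zero rcomp_power[OF dominant_translation] V2_b1_translated
    using assms(1-4) * assms(5,6) by (rule eigenfunction_fibration)
qed

lemma translating_fibration_after_translation:
  assumes "\<alpha> \<noteq> 0" "\<beta> \<noteq> 0" "k_periodic \<beta> \<gamma> k" "\<alpha> ^ k = 1" "\<alpha> \<noteq> 1"
  shows "\<exists>a b. conj_by_translation a b (f_map \<alpha>\<^sub>0 \<alpha> \<beta> \<gamma>) (f_map 0 \<alpha> \<beta> \<gamma>)
    \<and> second_invariant_fibration (f_map \<alpha>\<^sub>0 \<alpha> \<beta> \<gamma>) (H1 \<beta> \<gamma> k)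
        (V2_b2 \<alpha> \<beta> \<gamma> k \<circ>\<^sub>r translation (- a) (- b))"
proof (intro exI conjI)
  let ?a = "\<alpha>\<^sub>0 / (1 - \<alpha>)"
  have *: "\<alpha>\<^sub>0 = ?a * (1 - \<alpha>)"
    using assms(5) by simp
  show "conj_by_translation ?a 0 (f_map \<alpha>\<^sub>0 \<alpha> \<beta> \<gamma>) (f_map 0 \<alpha> \<beta> \<gamma>)"
    using assms(1,2) * by (rule conj_by_translation_f_map)
  have "of_nat k * (\<alpha>\<^sub>0 - ?a + \<alpha> * ?a) = \<alpha> * 0"
    by (subst *) (simp add: algebra_simps del: times_divide_eq_left times_divide_eq_right)
  then show "second_invariant_fibration (f_map \<alpha>\<^sub>0 \<alpha> \<beta> \<gamma>) (H1 \<beta> \<gamma> k)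
      (V2_b2 \<alpha> \<beta> \<gamma> k \<circ>\<^sub>r translation (- ?a) (- 0))"
    using translating_function_fibration(2)[OF assms(1-4), of 0 \<alpha>\<^sub>0 ?a]
    unfolding minus_zero V2_b2_translated by simp
qed

text \<open>
  The ratio of this geometric sum cannot be \<open>1\<close>, so it is a root of unity of order dividing the number of terms.
\<close>
lemma sum_powers_eq_0_imp:
  fixes \<alpha> :: complex
  assumes "(\<Sum>i\<le>n. \<alpha> ^ (i * k)) = 0"
  shows "\<alpha> ^ k \<noteq> 1" "\<alpha> ^ ((n + 1) * k) = 1"
proof -
  have *: "(\<Sum>i\<le>n. \<alpha> ^ (i * k)) = (\<Sum>i<Suc n. (\<alpha> ^ k) ^ i)"
    by (simp add: lessThan_Suc_atMost mult.commute flip: power_mult)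
  show "\<alpha> ^ k \<noteq> 1"
  proof
    assume "\<alpha> ^ k = 1"
    then have "of_nat (Suc n) = (0 :: complex)"
      using assms unfolding * by (simp del: sum.lessThan_Suc)
    then show False
      by (simp only: of_nat_eq_0_iff)
  qed
  have "(\<alpha> ^ k) ^ Suc n = 1"
    using power_diff_1_eq[of "\<alpha> ^ k" "Suc n"] assms unfolding *
    by (simp del: power_Suc sum.lessThan_Suc)
  then show "\<alpha> ^ ((n + 1) * k) = 1"
    unfolding mult.commute[of "n + 1" k] power_mult by simp
qed

theorem proposition9:
  fixes \<alpha>\<^sub>0 \<alpha>\<^sub>1 \<beta>\<^sub>0 \<gamma>\<^sub>0 :: complex
  assumes "\<alpha>\<^sub>1 \<noteq> 0" and "\<beta>\<^sub>0 \<noteq> 0"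
  shows
    "(\<not> periodic \<beta>\<^sub>0 \<gamma>\<^sub>0 \<longrightarrow> unique_invariant_fibration (f_map \<alpha>\<^sub>0 \<alpha>\<^sub>1 \<beta>\<^sub>0 \<gamma>\<^sub>0) Y)
     \<and>
     (\<forall>k. k_periodic \<beta>\<^sub>0 \<gamma>\<^sub>0 k \<and> (\<forall>n. (\<Sum>i\<le>n. \<alpha>\<^sub>1 ^ (i * k)) \<noteq> 0) \<longrightarrow>
        integrable_map (f_map \<alpha>\<^sub>0 \<alpha>\<^sub>1 \<beta>\<^sub>0 \<gamma>\<^sub>0)
        \<and> first_integral (f_map \<alpha>\<^sub>0 \<alpha>\<^sub>1 \<beta>\<^sub>0 \<gamma>\<^sub>0) (H1 \<beta>\<^sub>0 \<gamma>\<^sub>0 k)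
        \<and> (\<exists>V2. second_invariant_fibration (f_map \<alpha>\<^sub>0 \<alpha>\<^sub>1 \<beta>\<^sub>0 \<gamma>\<^sub>0) (H1 \<beta>\<^sub>0 \<gamma>\<^sub>0 k) V2)
        \<and> (\<alpha>\<^sub>1 ^ k \<noteq> 1 \<longrightarrow>
             (\<exists>a b. conj_by_translation a b (f_map \<alpha>\<^sub>0 \<alpha>\<^sub>1 \<beta>\<^sub>0 \<gamma>\<^sub>0) (f_map 0 \<alpha>\<^sub>1 \<beta>\<^sub>0 \<gamma>\<^sub>0)
                  \<and> second_invariant_fibration (f_map \<alpha>\<^sub>0 \<alpha>\<^sub>1 \<beta>\<^sub>0 \<gamma>\<^sub>0) (H1 \<beta>\<^sub>0 \<gamma>\<^sub>0 k)
                      (V2_b1 \<alpha>\<^sub>1 \<beta>\<^sub>0 \<gamma>\<^sub>0 k \<circ>\<^sub>r translation (- a) (- b)))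
             \<and> second_invariant_fibration (f_map 0 \<alpha>\<^sub>1 \<beta>\<^sub>0 \<gamma>\<^sub>0) (H1 \<beta>\<^sub>0 \<gamma>\<^sub>0 k) (V2_b1 \<alpha>\<^sub>1 \<beta>\<^sub>0 \<gamma>\<^sub>0 k)
             \<and> V2_b1 \<alpha>\<^sub>1 \<beta>\<^sub>0 \<gamma>\<^sub>0 k \<circ>\<^sub>r f_map 0 \<alpha>\<^sub>1 \<beta>\<^sub>0 \<gamma>\<^sub>0 = cst \<alpha>\<^sub>1 * V2_b1 \<alpha>\<^sub>1 \<beta>\<^sub>0 \<gamma>\<^sub>0 k)
        \<and> (\<alpha>\<^sub>1 ^ k = 1 \<and> \<alpha>\<^sub>1 \<noteq> 1 \<longrightarrow>
             (\<exists>a b. conj_by_translation a b (f_map \<alpha>\<^sub>0 \<alpha>\<^sub>1 \<beta>\<^sub>0 \<gamma>\<^sub>0) (f_map 0 \<alpha>\<^sub>1 \<beta>\<^sub>0 \<gamma>\<^sub>0)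
                  \<and> second_invariant_fibration (f_map \<alpha>\<^sub>0 \<alpha>\<^sub>1 \<beta>\<^sub>0 \<gamma>\<^sub>0) (H1 \<beta>\<^sub>0 \<gamma>\<^sub>0 k)
                      (V2_b2 \<alpha>\<^sub>1 \<beta>\<^sub>0 \<gamma>\<^sub>0 k \<circ>\<^sub>r translation (- a) (- b)))
             \<and> second_invariant_fibration (f_map 0 \<alpha>\<^sub>1 \<beta>\<^sub>0 \<gamma>\<^sub>0) (H1 \<beta>\<^sub>0 \<gamma>\<^sub>0 k) (V2_b2 \<alpha>\<^sub>1 \<beta>\<^sub>0 \<gamma>\<^sub>0 k)
             \<and> V2_b2 \<alpha>\<^sub>1 \<beta>\<^sub>0 \<gamma>\<^sub>0 k \<circ>\<^sub>r f_map 0 \<alpha>\<^sub>1 \<beta>\<^sub>0 \<gamma>\<^sub>0 = V2_b2 \<alpha>\<^sub>1 \<beta>\<^sub>0 \<gamma>\<^sub>0 k + 1)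
        \<and> (\<alpha>\<^sub>1 = 1 \<longrightarrow>
             second_invariant_fibration (f_map \<alpha>\<^sub>0 \<alpha>\<^sub>1 \<beta>\<^sub>0 \<gamma>\<^sub>0) (H1 \<beta>\<^sub>0 \<gamma>\<^sub>0 k) (V2_b3 \<alpha>\<^sub>0 \<beta>\<^sub>0 \<gamma>\<^sub>0 k)
             \<and> V2_b3 \<alpha>\<^sub>0 \<beta>\<^sub>0 \<gamma>\<^sub>0 k \<circ>\<^sub>r f_map \<alpha>\<^sub>0 \<alpha>\<^sub>1 \<beta>\<^sub>0 \<gamma>\<^sub>0 = V2_b3 \<alpha>\<^sub>0 \<beta>\<^sub>0 \<gamma>\<^sub>0 k + 1))
     \<and>
     (\<forall>k n. k_periodic \<beta>\<^sub>0 \<gamma>\<^sub>0 k \<and> (\<Sum>i\<le>n. \<alpha>\<^sub>1 ^ (i * k)) = 0 \<longrightarrow>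
        first_integral (f_map \<alpha>\<^sub>0 \<alpha>\<^sub>1 \<beta>\<^sub>0 \<gamma>\<^sub>0) (H1 \<beta>\<^sub>0 \<gamma>\<^sub>0 k)
        \<and> (\<exists>H2. second_first_integral (f_map \<alpha>\<^sub>0 \<alpha>\<^sub>1 \<beta>\<^sub>0 \<gamma>\<^sub>0) (H1 \<beta>\<^sub>0 \<gamma>\<^sub>0 k) H2)
        \<and> (\<exists>a b. conj_by_translation a b (f_map \<alpha>\<^sub>0 \<alpha>\<^sub>1 \<beta>\<^sub>0 \<gamma>\<^sub>0) (f_map 0 \<alpha>\<^sub>1 \<beta>\<^sub>0 \<gamma>\<^sub>0)
               \<and> second_first_integral (f_map \<alpha>\<^sub>0 \<alpha>\<^sub>1 \<beta>\<^sub>0 \<gamma>\<^sub>0) (H1 \<beta>\<^sub>0 \<gamma>\<^sub>0 k)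
                   (V2_b1 \<alpha>\<^sub>1 \<beta>\<^sub>0 \<gamma>\<^sub>0 k ^ ((n + 1) * k) \<circ>\<^sub>r translation (- a) (- b)))
        \<and> second_first_integral (f_map 0 \<alpha>\<^sub>1 \<beta>\<^sub>0 \<gamma>\<^sub>0) (H1 \<beta>\<^sub>0 \<gamma>\<^sub>0 k) (V2_b1 \<alpha>\<^sub>1 \<beta>\<^sub>0 \<gamma>\<^sub>0 k ^ ((n + 1) * k)))"
proof -
  let ?f = "f_map \<alpha>\<^sub>0 \<alpha>\<^sub>1 \<beta>\<^sub>0 \<gamma>\<^sub>0" and ?g = "f_map 0 \<alpha>\<^sub>1 \<beta>\<^sub>0 \<gamma>\<^sub>0"
  let ?H = "H1 \<beta>\<^sub>0 \<gamma>\<^sub>0"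
  let ?V = "V2_b1 \<alpha>\<^sub>1 \<beta>\<^sub>0 \<gamma>\<^sub>0" and ?W = "V2_b2 \<alpha>\<^sub>1 \<beta>\<^sub>0 \<gamma>\<^sub>0" and ?Z = "V2_b3 \<alpha>\<^sub>0 \<beta>\<^sub>0 \<gamma>\<^sub>0"
  have a: "unique_invariant_fibration ?f Y" if "\<not> periodic \<beta>\<^sub>0 \<gamma>\<^sub>0"
    using assms that by (rule unique_invariant_fibration_Y)
  have H: "first_integral ?f (?H k)" if "k_periodic \<beta>\<^sub>0 \<gamma>\<^sub>0 k" for k
    using assms that by (intro first_integral_H1) simp_all
  then have int: "integrable_map ?f" if "k_periodic \<beta>\<^sub>0 \<gamma>\<^sub>0 k" for k
    using that by (auto simp: integrable_map_def)
  note b1 = eigenfunction_fibration_after_translation[OF assms, of \<gamma>\<^sub>0 _ \<alpha>\<^sub>0]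
  have b1': "second_invariant_fibration ?g (?H k) (?V k)" "?V k \<circ>\<^sub>r ?g = cst \<alpha>\<^sub>1 * ?V k"
    if "k_periodic \<beta>\<^sub>0 \<gamma>\<^sub>0 k" "\<alpha>\<^sub>1 ^ k \<noteq> 1" for k
    using eigenfunction_fibration(1,2)[OF assms that, of 0 0] by (simp_all add: V2_b1_eq)
  note b2 = translating_fibration_after_translation[OF assms, of \<gamma>\<^sub>0 _ \<alpha>\<^sub>0]
  have b2': "second_invariant_fibration ?g (?H k) (?W k)" "?W k \<circ>\<^sub>r ?g = ?W k + 1"
    if "k_periodic \<beta>\<^sub>0 \<gamma>\<^sub>0 k" "\<alpha>\<^sub>1 ^ k = 1" for k
    using translating_function_fibration[OF assms that, of 0 0 0] by (simp_all add: V2_b2_eq)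
  have b3: "second_invariant_fibration ?f (?H k) (?Z k)" "?Z k \<circ>\<^sub>r ?f = ?Z k + 1"
    if "k_periodic \<beta>\<^sub>0 \<gamma>\<^sub>0 k" "\<alpha>\<^sub>1 = 1" for k
    using translating_function_fibration[OF assms that(1), of "of_nat k * \<alpha>\<^sub>0" \<alpha>\<^sub>0 0] that(2)
    unfolding V2_b3_eq by simp_all
  have b: "\<exists>V. second_invariant_fibration ?f (?H k) V" if "k_periodic \<beta>\<^sub>0 \<gamma>\<^sub>0 k" for k
    using b1[OF that] b2[OF that] b3(1)[OF that] by blast
  have c: "\<exists>a b. conj_by_translation a b ?f ?g
      \<and> second_first_integral ?f (?H k) (?V k ^ ((n + 1) * k) \<circ>\<^sub>r translation (- a) (- b))"
    "second_first_integral ?g (?H k) (?V k ^ ((n + 1) * k))"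
    if "k_periodic \<beta>\<^sub>0 \<gamma>\<^sub>0 k" "(\<Sum>i\<le>n. \<alpha>\<^sub>1 ^ (i * k)) = 0" for k n
  proof -
    note pow = sum_powers_eq_0_imp[OF that(2)]
    have "(n + 1) * k > 0"
      using that(1) by (simp add: k_periodic_def)
    note * = assms that(1) pow(1) this pow(2)
    show "\<exists>a b. conj_by_translation a b ?f ?g
      \<and> second_first_integral ?f (?H k) (?V k ^ ((n + 1) * k) \<circ>\<^sub>r translation (- a) (- b))"
      using * by (rule second_first_integral_after_translation)
    show "second_first_integral ?g (?H k) (?V k ^ ((n + 1) * k))"
      using eigenfunction_fibration(3)[OF *(1-4) _ *(5,6), of 0 0]
      by (simp only: V2_b1_eq mult_zero_left cst_simps diff_zero simp_thms)
  qed
  have c': "\<exists>V. second_first_integral ?f (?H k) V"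
    if "k_periodic \<beta>\<^sub>0 \<gamma>\<^sub>0 k" "(\<Sum>i\<le>n. \<alpha>\<^sub>1 ^ (i * k)) = 0" for k n
    using c(1)[OF that] by blast
  show ?thesis
    by (intro conjI allI impI; (elim conjE)?;
        (rule a int H b b1 b1' b2 b2' b3 c c'; assumption))
qed

end
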